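(* Let $X=(X_t)_{t\in T}$ be an infinitely divisible process given by $$X_t=G_t+\int_SV_t(s)\big[N(ds)-\chi(V_t(s))\,n(ds)\big]+b(t),\qquad t\in T,$$ where $V=(V_t)_{t\in T}$ is a representation of the Lévy measure of $X$ defined on a $\sigma$-finite measure space $(S,\mathcal{S},n)$, $N$ is a Poisson random measure on $(S,\mathcal{S})$ with intensity $n$, $G=(G_t)_{t\in T}$ is a centered Gaussian process independent of $N$, and $b$ is a shift function. Choose an arbitrary measurable function $q:S\to\mathbb{R}_+$ such that $\int_Sq(s)\,n(ds)=1$. Then for any measurable functional $F:\mathbb{R}^T\to\mathbb{R}$ $$\int_S\mathbb{E}F\big((X_t+V_t(s))_{t\in T}\big)\,q(s)\,n(ds)=\mathbb{E}\big[F\big((X_t)_{t\in T}\big)\,N(q)\big],\qquad N(q)=\int_Sq(s)\,N(ds).$$ Conversely, for any measurable functional $F:\mathbb{R}^T\to\mathbb{R}$, $$\mathbb{E}\big[F\big((X_t)_{t\in T}\big)\mathbf{1}_{\{N(q)>0\}}\big]=\int_S\mathbb{E}\big[F\big((X_t+V_t(s))_{t\in T}\big)\,(N(q)+q(s))^{-1}\big]\,q(s)\,n(ds).$$ If $n\{s\in S:q(s)>0\}=\infty$, then $$\mathbb{E}\big[F\big((X_t)_{t\in T}\big)\big]=\int_S\mathbb{E}\big[F\big((X_t+V_t(s))_{t\in T}\big)\,(N(q)+q(s))^{-1}\big]\,q(s)\,n(ds).$$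
   Context: $T$ is an arbitrary nonempty set, $\mathbb{R}^T$ the space of all functions $x:T\to\mathbb{R}$, $\mathcal{B}^T$ its cylindrical (product) $\sigma$-algebra, $x_I$ the restriction of $x$ to $I\subset T$, $0_I$ the origin of $\mathbb{R}^I$, $\pi_I(x)=x_I$, $\mathcal{B}_0^I=\{B\in\mathcal{B}^I:0_I\notin B\}$. Convention $0\cdot\infty=0$. An identity between expectations reads: if one side exists then the other does and they are equal. A measure $\nu$ on $(\mathbb{R}^T,\mathcal{B}^T)$ is a Lévy measure if (L1) $\int|x(t)|^2\wedge1\,\nu(dx)<\infty$ for every $t\in T$, and (L2) $\nu(A)=\nu_*(A\setminus\{0_T\})$ for every $A\in\mathcal{B}^T$, where $\nu_*(E)=\sup\{\nu(D):D\subset E,\ D\in\mathcal{B}^T\}$. A process $X$ is infinitely divisible if all its finite-dimensional distributions are. Its Lévy measure is the unique Lévy measure $\nu$ on $(\mathbb{R}^T,\mathcal{B}^T)$ such that, for a (symmetric) non-negative definite $\Sigma$ on $T\times T$, some $b'\in\mathbb{R}^T$, all finite nonempty $I\subset T$ and $a\in\mathbb{R}^I$, $\mathbb{E}e^{i\sum_{t\in I}a_tX_t}=\exp\{-\frac12\sum_{s,t\in I}a_sa_t\Sigma(s,t)+\int_{\mathbb{R}^T}(e^{i\sum_{t\in I}a_tx(t)}-1-i\sum_{t\in I}a_tx(t)\mathbf{1}_{\{|x(t)|\le1\}})\,\nu(dx)+i\sum_{t\in I}a_tb'(t)\}$. A representation of $\nu$ is a collection $V=(V_t)_{t\in T}$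 of measurable real functions on a measure space $(S,\mathcal{S},n)$ such that $n\{s:V_I(s)\in B\}=\nu(\pi_I^{-1}(B))$ for every finite nonempty $I\subset T$ and $B\in\mathcal{B}_0^I$, where $V_I=(V_t)_{t\in I}$. A cutoff function is a fixed bounded measurable $\chi:\mathbb{R}\to\mathbb{R}$ with $\chi(v)=1+o(|v|)$ as $v\to0$ and $\chi(v)=O(|v|^{-1})$ as $|v|\to\infty$. A Poisson random measure $N$ on $(S,\mathcal{S})$ with intensity $n$ is a family $(N(A))_{A\in\mathcal{S}}$ with $N(A)$ Poisson with mean $n(A)$ ($N(A)=\infty$ a.s. if $n(A)=\infty$), independent over disjoint sets, and countably additive a.s. For measurable $f$ with $\int f^2\wedge1\,dn<\infty$, $\int f\,[dN-\chi(f)\,dn]$ denotes $\int f\mathbf{1}_{\{|f|\le1\}}d(N-n)+\int f\mathbf{1}_{\{|f|>1\}}dN+\int f(\mathbf{1}_{\{|f|\le1\}}-\chi(f))\,dn$, the first term being the $L^2$-limit of integrals of simple functions. *)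

theory Defs
  imports "HOL-Probability.Probability" "HOL-Library.Landau_Symbols"
begin

text \<open>
  The index set is the type \<open>'t\<close> (all types are nonempty), so that \<open>'t \<Rightarrow> real\<close> is the space of all
  paths. For a subset \<open>I\<close> the space of functions on \<open>I\<close> is represented, as in the library, by the
  functions that are \<open>undefined\<close> outside \<open>I\<close>; its origin is \<open>\<lambda>t\<in>I. 0\<close>.
\<close>

abbreviation cyl :: "'t set \<Rightarrow> ('t \<Rightarrow> real) measure" where
  "cyl I \<equiv> PiM I (\<lambda>_. borel)"

definition inner_measure :: "'a measure \<Rightarrow> 'a set \<Rightarrow> ennreal" where
  "inner_measure \<nu> E = (SUP D\<in>{D \<in> sets \<nu>. D \<subseteq> E}. emeasure \<nu> D)"

text \<open>
  The second condition involves the inner measure because the singleton of the origin is not a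
  cylindrical event when the index set is uncountable.
\<close>

definition levy_measure :: "('t \<Rightarrow> real) measure \<Rightarrow> bool" where
  "levy_measure \<nu> \<longleftrightarrow>
     sets \<nu> = sets (cyl UNIV) \<and>
     (\<forall>t. (\<integral>\<^sup>+x. ennreal (min (\<bar>x t\<bar>\<^sup>2) 1) \<partial>\<nu>) < \<infinity>) \<and>
     (\<forall>A\<in>sets \<nu>. emeasure \<nu> A = inner_measure \<nu> (A - {\<lambda>_. 0}))"

definition infinitely_divisible_law :: "'t set \<Rightarrow> ('t \<Rightarrow> real) measure \<Rightarrow> bool" where
  "infinitely_divisible_law I \<mu> \<longleftrightarrow>
     (\<forall>k::nat. k \<ge> 1 \<longrightarrow>
        (\<exists>\<rho>. prob_space \<rho> \<and> sets \<rho> = sets (cyl I) \<and>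
             \<mu> = distr (PiM {..<k} (\<lambda>_. \<rho>)) (cyl I) (\<lambda>y. \<lambda>t\<in>I. \<Sum>j<k. y j t)))"

definition infinitely_divisible_process :: "'w measure \<Rightarrow> ('t \<Rightarrow> 'w \<Rightarrow> real) \<Rightarrow> bool" where
  "infinitely_divisible_process M X \<longleftrightarrow>
     (\<forall>t. X t \<in> borel_measurable M) \<and>
     (\<forall>I. finite I \<and> I \<noteq> {} \<longrightarrow>
        infinitely_divisible_law I (distr M (cyl I) (\<lambda>\<omega>. \<lambda>t\<in>I. X t \<omega>)))"

definition nonneg_definite :: "('t \<Rightarrow> 't \<Rightarrow> real) \<Rightarrow> bool" where
  "nonneg_definite C \<longleftrightarrow>
     (\<forall>s t. C s t = C t s) \<and>
     (\<forall>I a. finite I \<longrightarrow> 0 \<le> (\<Sum>s\<in>I. \<Sum>t\<in>I. a s * a t * C s t))"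

definition levy_measure_of ::
    "'w measure \<Rightarrow> ('t \<Rightarrow> 'w \<Rightarrow> real) \<Rightarrow> ('t \<Rightarrow> real) measure \<Rightarrow> bool" where
  "levy_measure_of M X \<nu> \<longleftrightarrow>
     levy_measure \<nu> \<and>
     (\<exists>C b'. nonneg_definite C \<and>
        (\<forall>I a. finite I \<and> I \<noteq> {} \<longrightarrow>
           (LINT \<omega>|M. exp (\<i> * complex_of_real (\<Sum>t\<in>I. a t * X t \<omega>))) =
           exp (- complex_of_real ((\<Sum>s\<in>I. \<Sum>t\<in>I. a s * a t * C s t) / 2)
                + (LINT x|\<nu>. exp (\<i> * complex_of_real (\<Sum>t\<in>I. a t * x t)) - 1
                     - \<i> * complex_of_real
                         (\<Sum>t\<in>I. a t * x t * (if \<bar>x t\<bar> \<le> 1 then 1 else 0)))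
                + \<i> * complex_of_real (\<Sum>t\<in>I. a t * b' t))))"

definition levy_representation ::
    "'s measure \<Rightarrow> ('t \<Rightarrow> 's \<Rightarrow> real) \<Rightarrow> ('t \<Rightarrow> real) measure \<Rightarrow> bool" where
  "levy_representation n V \<nu> \<longleftrightarrow>
     (\<forall>t. V t \<in> borel_measurable n) \<and>
     (\<forall>I B. finite I \<and> I \<noteq> {} \<and> B \<in> sets (cyl I) \<and> (\<lambda>t\<in>I. 0) \<notin> B \<longrightarrow>
        emeasure n {s \<in> space n. (\<lambda>t\<in>I. V t s) \<in> B} =
        emeasure \<nu> {x \<in> space \<nu>. restrict x I \<in> B})"

text \<open>A linear combination may be degenerate; the library's normal density covers \<open>\<sigma> > 0\<close> only.\<close>

definition centered_gaussian_process :: "'w measure \<Rightarrow> ('t \<Rightarrow> 'w \<Rightarrow> real) \<Rightarrow> bool" where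
  "centered_gaussian_process M G \<longleftrightarrow>
     (\<forall>t. G t \<in> borel_measurable M) \<and>
     (\<forall>I a. finite I \<longrightarrow>
        (AE \<omega> in M. (\<Sum>t\<in>I. a t * G t \<omega>) = 0) \<or>
        (\<exists>\<sigma>>0. distributed M lborel (\<lambda>\<omega>. \<Sum>t\<in>I. a t * G t \<omega>)
                  (\<lambda>x. ennreal (normal_density 0 \<sigma> x))))"

text \<open>
  A Poisson random measure is a family of random variables indexed by the measurable sets. The
  exceptional null set in the countable additivity may depend on the sequence of sets, hence
  \<open>\<lambda>A. N A \<omega>\<close> need not be a measure for any fixed \<open>\<omega>\<close>. Independence over finitely many disjoint
  sets is included, as one can continue the sequence by empty sets.
\<close>

definition poisson_random_measure ::
    "'w measure \<Rightarrow> 's measure \<Rightarrow> ('s set \<Rightarrow> 'w \<Rightarrow> ennreal) \<Rightarrow> bool" where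
  "poisson_random_measure M n N \<longleftrightarrow>
     (\<forall>A\<in>sets n. N A \<in> borel_measurable M) \<and>
     (\<forall>A\<in>sets n. emeasure n A < \<infinity> \<longrightarrow>
        (\<forall>k::nat. measure M {\<omega> \<in> space M. N A \<omega> = of_nat k} =
                   measure n A ^ k / fact k * exp (- measure n A))) \<and>
     (\<forall>A\<in>sets n. emeasure n A = \<infinity> \<longrightarrow> (AE \<omega> in M. N A \<omega> = \<infinity>)) \<and>
     (\<forall>A::nat \<Rightarrow> 's set. range A \<subseteq> sets n \<and> disjoint_family A \<longrightarrow>
        prob_space.indep_vars M (\<lambda>_. borel) (\<lambda>i. N (A i)) UNIV \<and>
        (AE \<omega> in M. N (\<Union>i. A i) \<omega> = (\<Sum>i. N (A i) \<omega>)))"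

definition indep_process_prm ::
    "'w measure \<Rightarrow> ('t \<Rightarrow> 'w \<Rightarrow> real) \<Rightarrow> 's measure \<Rightarrow> ('s set \<Rightarrow> 'w \<Rightarrow> ennreal) \<Rightarrow> bool" where
  "indep_process_prm M G n N \<longleftrightarrow>
     prob_space.indep_set M
       {(\<lambda>\<omega> t. G t \<omega>) -` B \<inter> space M |B. B \<in> sets (cyl UNIV)}
       {(\<lambda>\<omega>. \<lambda>A\<in>sets n. N A \<omega>) -` B \<inter> space M |B. B \<in> sets (PiM (sets n) (\<lambda>_. borel))}"

text \<open>
  The integrals are determined up to almost sure equality only, so they are given as relations:
  the last argument is a version of the integral.
\<close>

definition prm_simple :: "'s measure \<Rightarrow> ('s set \<Rightarrow> 'w \<Rightarrow> ennreal) \<Rightarrow> ('s \<Rightarrow> ennreal) \<Rightarrow> 'w \<Rightarrow> ennreal" where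
  "prm_simple n N g \<omega> = (\<Sum>y\<in>g ` space n. y * N (g -` {y} \<inter> space n) \<omega>)"

definition prm_nn_integral ::
    "'w measure \<Rightarrow> 's measure \<Rightarrow> ('s set \<Rightarrow> 'w \<Rightarrow> ennreal) \<Rightarrow> ('s \<Rightarrow> ennreal) \<Rightarrow> ('w \<Rightarrow> ennreal) \<Rightarrow> bool" where
  "prm_nn_integral M n N f Y \<longleftrightarrow>
     Y \<in> borel_measurable M \<and>
     (\<exists>g::nat \<Rightarrow> 's \<Rightarrow> ennreal. (\<forall>k. simple_function n (g k)) \<and> incseq g \<and>
        (\<forall>s\<in>space n. (SUP k. g k s) = f s) \<and>
        (AE \<omega> in M. Y \<omega> = (SUP k. prm_simple n N (g k) \<omega>)))"

text \<open>Integral of a real function whose positive and negative part have almost surely finite integral.\<close>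

definition prm_real_integral ::
    "'w measure \<Rightarrow> 's measure \<Rightarrow> ('s set \<Rightarrow> 'w \<Rightarrow> ennreal) \<Rightarrow> ('s \<Rightarrow> real) \<Rightarrow> ('w \<Rightarrow> real) \<Rightarrow> bool" where
  "prm_real_integral M n N f Y \<longleftrightarrow>
     Y \<in> borel_measurable M \<and>
     (\<exists>P Q. prm_nn_integral M n N (\<lambda>s. ennreal (f s)) P \<and>
            prm_nn_integral M n N (\<lambda>s. ennreal (- f s)) Q \<and>
            (AE \<omega> in M. P \<omega> < \<infinity> \<and> Q \<omega> < \<infinity> \<and> Y \<omega> = enn2real (P \<omega>) - enn2real (Q \<omega>)))"

definition prm_simple_compensated ::
    "'s measure \<Rightarrow> ('s set \<Rightarrow> 'w \<Rightarrow> ennreal) \<Rightarrow> ('s \<Rightarrow> real) \<Rightarrow> 'w \<Rightarrow> real" where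
  "prm_simple_compensated n N g \<omega> =
     (\<Sum>y\<in>g ` space n - {0}. y * (enn2real (N (g -` {y} \<inter> space n) \<omega>) - measure n (g -` {y} \<inter> space n)))"

definition prm_L2_compensated ::
    "'w measure \<Rightarrow> 's measure \<Rightarrow> ('s set \<Rightarrow> 'w \<Rightarrow> ennreal) \<Rightarrow> ('s \<Rightarrow> real) \<Rightarrow> ('w \<Rightarrow> real) \<Rightarrow> bool" where
  "prm_L2_compensated M n N f Y \<longleftrightarrow>
     Y \<in> borel_measurable M \<and>
     (\<exists>g::nat \<Rightarrow> 's \<Rightarrow> real.
        (\<forall>k. simple_function n (g k) \<and> emeasure n {s \<in> space n. g k s \<noteq> 0} < \<infinity>) \<and>
        (\<lambda>k. \<integral>\<^sup>+s. ennreal ((g k s - f s)\<^sup>2) \<partial>n) \<longlonglongrightarrow> 0 \<and>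
        (\<lambda>k. \<integral>\<^sup>+\<omega>. ennreal ((prm_simple_compensated n N (g k) \<omega> - Y \<omega>)\<^sup>2) \<partial>M) \<longlonglongrightarrow> 0)"

definition cutoff_function :: "(real \<Rightarrow> real) \<Rightarrow> bool" where
  "cutoff_function chi \<longleftrightarrow>
     chi \<in> borel_measurable borel \<and> bounded (range chi) \<and>
     (\<lambda>v. chi v - 1) \<in> o[at 0](\<lambda>v. \<bar>v\<bar>) \<and>
     chi \<in> O[at_infinity](\<lambda>v. 1 / \<bar>v\<bar>)"

text \<open>\<open>Y\<close> is a version of the integral of \<open>f\<close> against \<open>N(ds) - chi(f(s)) n(ds)\<close>.\<close>

definition prm_cutoff_integral ::
    "'w measure \<Rightarrow> 's measure \<Rightarrow> ('s set \<Rightarrow> 'w \<Rightarrow> ennreal) \<Rightarrow> (real \<Rightarrow> real) \<Rightarrow>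
       ('s \<Rightarrow> real) \<Rightarrow> ('w \<Rightarrow> real) \<Rightarrow> bool" where
  "prm_cutoff_integral M n N chi f Y \<longleftrightarrow>
     f \<in> borel_measurable n \<and> (\<integral>\<^sup>+s. ennreal (min ((f s)\<^sup>2) 1) \<partial>n) < \<infinity> \<and>
     (\<exists>Y1 Y2.
        prm_L2_compensated M n N (\<lambda>s. if \<bar>f s\<bar> \<le> 1 then f s else 0) Y1 \<and>
        prm_real_integral M n N (\<lambda>s. if \<bar>f s\<bar> > 1 then f s else 0) Y2 \<and>
        (AE \<omega> in M. Y \<omega> = Y1 \<omega> + Y2 \<omega>
           + (LINT s|n. f s * ((if \<bar>f s\<bar> \<le> 1 then 1 else 0) - chi (f s)))))"

text \<open>
  An expectation exists if the positive or the negative part of the integrand has finite integral;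
  its value is then an extended real number. A non-existing expectation is \<open>None\<close>, so that an
  equation between two such terms says that one side exists iff the other does, and that the values
  then agree. Note that \<open>e2ennreal\<close> truncates negative numbers to 0 and that \<open>0 * \<infinity> = 0\<close> both in
  \<open>ereal\<close> and in \<open>ennreal\<close>.
\<close>

definition ext_value :: "'a measure \<Rightarrow> ('a \<Rightarrow> ereal) \<Rightarrow> ereal" where
  "ext_value M f =
     enn2ereal (\<integral>\<^sup>+x. e2ennreal (f x) \<partial>M) - enn2ereal (\<integral>\<^sup>+x. e2ennreal (- f x) \<partial>M)"

definition ext_expectation :: "'a measure \<Rightarrow> ('a \<Rightarrow> ereal) \<Rightarrow> ereal option" where
  "ext_expectation M f =
     (if (\<integral>\<^sup>+x. e2ennreal (f x) \<partial>M) < \<infinity> \<or> (\<integral>\<^sup>+x. e2ennreal (- f x) \<partial>M) < \<infinity>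
      then Some (ext_value M f) else None)"

text \<open>
  The iterated integral of \<open>E[\<Phi>(s)] q(s)\<close> with respect to \<open>n\<close>. It exists if the positive or the
  negative part of \<open>\<Phi>\<close> has finite iterated integral; by Tonelli's theorem this is existence with
  respect to the product of \<open>M\<close> and \<open>q n\<close>. Then \<open>E[\<Phi>(s)]\<close> exists for almost all \<open>s\<close> with
  \<open>q s > 0\<close>, and the value is the integral over \<open>s\<close> of these expectations. Requiring only that the
  inner expectations and the integral of their values exist would be too weak: positive and negative
  parts could then cancel inside the inner expectation.
\<close>

definition ext_iterated ::
    "'s measure \<Rightarrow> ('s \<Rightarrow> real) \<Rightarrow> 'w measure \<Rightarrow> ('s \<Rightarrow> 'w \<Rightarrow> ereal) \<Rightarrow> ereal option" where
  "ext_iterated n q M \<Phi> =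
     (if (\<integral>\<^sup>+s. (\<integral>\<^sup>+\<omega>. e2ennreal (\<Phi> s \<omega>) \<partial>M) * ennreal (q s) \<partial>n) < \<infinity> \<or>
         (\<integral>\<^sup>+s. (\<integral>\<^sup>+\<omega>. e2ennreal (- \<Phi> s \<omega>) \<partial>M) * ennreal (q s) \<partial>n) < \<infinity>
      then Some (ext_value n (\<lambda>s. ext_value M (\<Phi> s) * ereal (q s))) else None)"

end

theory Submission
  imports Defs
begin

text \<open>
  The three identities are cases of one. For a nonnegative measurable \<open>K\<close> on the space of pairs of
  a path and a mass,
  \<open>E [K (X, N(q)) * N(q)] = \<integral> E [K (X + V(s), N(q) + q(s))] * q(s) n(ds)\<close>.
  With \<open>K (x, r)\<close> the positive or the negative part of \<open>F x\<close> this is the first claim; with that part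
  divided by \<open>r\<close> it is the second one, because \<open>N(q) / N(q)\<close> is the indicator of \<open>N(q) > 0\<close>. If
  \<open>q\<close> is positive on a set of infinite measure, this indicator is almost surely 1, which gives the
  third one.

  The identity is a form of Mecke's formula: weighting the probability with \<open>N(q)\<close> amounts to adding
  to the Poisson measure an atom at a random point with law \<open>q n\<close>. It cannot be read off from a
  formula for sums over atoms, since here \<open>N\<close> is only a family of random variables, and no realisation
  of it needs to be a measure. What replaces the atoms is a notion of increment: \<open>has_increment Y h\<close>
  says that a functional \<open>Y\<close> of the noise changes by \<open>h s\<close> if an atom is added at \<open>s\<close>, and it is
  defined by approximation with linear combinations of the variables \<open>N A\<close>. The proof goes from such
  combinations to the general case.

  \<^item> For one set, \<open>E [\<psi> (N A) N A] = n A * E [\<psi> (N A + 1)]\<close> is a property of the Poisson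
    distribution (\<open>nn_integral_N_size_biased\<close>).
  \<^item> Finitely many simple functions are constant on the cells of a common finite partition, the masses
    of the cells are independent of each other and of \<open>G\<close>, and so the one-dimensional statement can be
    applied to each cell in turn (\<open>nn_integral_simple_Mecke\<close>).
  \<^item> For bounded continuous functions of finitely many coordinates both sides survive almost sure limits
    of the functionals together with almost everywhere limits of their increments
    (\<open>nn_integral_continuous_Mecke\<close>). Finite-dimensional boxes determine a finite measure on the path
    space, hence the formula holds for all measurable functions of a path, with a weight \<open>N B\<close>
    (\<open>nn_integral_path_Mecke\<close>).
  \<^item> Linearity and monotone convergence turn the weights \<open>N B\<close> into the weight \<open>N(q)\<close>
    (\<open>nn_integral_prm_nn_integral\<close>).

  It remains to see that the stochastic integral defining \<open>X t\<close> has increment \<open>V t\<close>, that \<open>N(q)\<close> has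
  increment \<open>q\<close>, and that the path may be extended by \<open>N(q)\<close> as one more coordinate
  (\<open>has_increment_cutoff_integral\<close>, \<open>nn_integral_weighted_Mecke\<close>).
\<close>

section \<open>Poisson random measures on disjoint sets\<close>

locale poisson_noise = prob_space M for M :: "'w measure" +
  fixes n :: "'s measure" and N :: "'s set \<Rightarrow> 'w \<Rightarrow> ennreal"
  assumes prm: "poisson_random_measure M n N"
begin

lemma N_measurable [measurable]: "A \<in> sets n \<Longrightarrow> N A \<in> borel_measurable M"
  using prm by (simp add: poisson_random_measure_def)

lemma N_prob:
  assumes "A \<in> sets n" "emeasure n A < \<infinity>"
  shows "prob {\<omega> \<in> space M. N A \<omega> = of_nat k} = measure n A ^ k / fact k * exp (- measure n A)"
  using prm assms by (simp add: poisson_random_measure_def)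

lemma N_seq:
  assumes "range A \<subseteq> sets n" "disjoint_family (A :: nat \<Rightarrow> 's set)"
  shows N_indep: "indep_vars (\<lambda>_. borel) (\<lambda>i. N (A i)) UNIV"
    and N_sigma_additive: "AE \<omega> in M. N (\<Union>i. A i) \<omega> = (\<Sum>i. N (A i) \<omega>)"
  using prm assms by (simp_all add: poisson_random_measure_def)

text \<open>
  The Poisson weights sum to 1, so no mass is left for values that are not natural numbers.
\<close>
lemma AE_N_of_nat:
  assumes A: "A \<in> sets n" "emeasure n A < \<infinity>"
  shows "AE \<omega> in M. \<exists>k. N A \<omega> = of_nat k"
proof -
  note [measurable] = A(1)
  have "(\<lambda>k. measure n A ^ k / fact k * exp (- measure n A)) sums (exp (measure n A) * exp (- measure n A))"
    using sums_mult2[OF exp_converges[of "measure n A"], of "exp (- measure n A)"]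
    by (simp add: field_simps)
  then have "(\<lambda>k. prob {\<omega> \<in> space M. N A \<omega> = of_nat k}) sums 1"
    by (simp add: N_prob[OF A] flip: exp_add)
  moreover have "(\<lambda>k. prob {\<omega> \<in> space M. N A \<omega> = of_nat k}) sums
      prob (\<Union>k. {\<omega> \<in> space M. N A \<omega> = of_nat k})"
    by (intro finite_measure_UNION) (auto simp: disjoint_family_on_def)
  ultimately have "prob (\<Union>k. {\<omega> \<in> space M. N A \<omega> = of_nat k}) = 1"
    using sums_unique2 by blast
  from AE_prob_1[OF this] show ?thesis
    by eventually_elim auto
qed

lemma AE_N_finite:
  assumes A: "A \<in> sets n" "emeasure n A < \<infinity>"
  shows "AE \<omega> in M. N A \<omega> < \<infinity>"
  using AE_N_of_nat[OF A] by eventually_elim (auto simp: of_nat_less_top)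

lemma nn_integral_N:
  assumes A: "A \<in> sets n" "emeasure n A < \<infinity>" and [measurable]: "\<psi> \<in> borel_measurable borel"
  shows "(\<integral>\<^sup>+\<omega>. \<psi> (N A \<omega>) \<partial>M) =
    (\<Sum>k. \<psi> (of_nat k) * ennreal (measure n A ^ k / fact k * exp (- measure n A)))"
proof -
  note [measurable] = A(1)
  have "(\<integral>\<^sup>+\<omega>. \<psi> (N A \<omega>) \<partial>M) =
     (\<integral>\<^sup>+\<omega>. (\<Sum>k. \<psi> (of_nat k) * indicator {\<omega> \<in> space M. N A \<omega> = of_nat k} \<omega>) \<partial>M)"
  proof (intro nn_integral_cong_AE)
    show "AE \<omega> in M. \<psi> (N A \<omega>) =
        (\<Sum>k. \<psi> (of_nat k) * indicator {\<omega> \<in> space M. N A \<omega> = of_nat k} \<omega>)"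
      using AE_N_of_nat[OF A] AE_space
    proof eventually_elim
      case (elim \<omega>)
      then obtain k where k: "N A \<omega> = of_nat k" by auto
      have "(\<Sum>j. \<psi> (of_nat j) * indicator {\<omega> \<in> space M. N A \<omega> = of_nat j} \<omega>) =
          (\<Sum>j\<in>{k}. \<psi> (of_nat j) * indicator {\<omega> \<in> space M. N A \<omega> = of_nat j} \<omega>)"
        by (rule suminf_finite) (auto simp: k indicator_def)
      then show ?case using k elim by simp
    qed
  qed
  also have "\<dots> = (\<Sum>k. \<integral>\<^sup>+\<omega>. \<psi> (of_nat k) * indicator {\<omega> \<in> space M. N A \<omega> = of_nat k} \<omega> \<partial>M)"
    by (intro nn_integral_suminf) measurable
  also have "\<dots> = (\<Sum>k. \<psi> (of_nat k) * ennreal (measure n A ^ k / fact k * exp (- measure n A)))"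
    by (simp add: nn_integral_cmult_indicator emeasure_eq_measure N_prob[OF A])
  finally show ?thesis .
qed

text \<open>
  For the Poisson weights \<open>p k\<close> with mean \<open>l\<close>, \<open>(k + 1) * p (k + 1) = l * p k\<close>. Summation by shifting the
  index is Mecke's formula for a single set.
\<close>
lemma nn_integral_N_size_biased:
  assumes A: "A \<in> sets n" "emeasure n A < \<infinity>" and [measurable]: "\<psi> \<in> borel_measurable borel"
  shows "(\<integral>\<^sup>+\<omega>. \<psi> (N A \<omega>) * N A \<omega> \<partial>M) = emeasure n A * (\<integral>\<^sup>+\<omega>. \<psi> (N A \<omega> + 1) \<partial>M)"
proof -
  let ?l = "measure n A"
  let ?p = "\<lambda>k. ?l ^ k / fact k * exp (- ?l)"
  have pos: "0 \<le> ?p k" for k by simp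
  have step: "of_nat (Suc k) * ennreal (?p (Suc k)) = ennreal ?l * ennreal (?p k)" for k
  proof -
    have "real (Suc k) * ?p (Suc k) = ?l * ?p k"
      by (simp add: field_simps del: of_nat_Suc)
    then show ?thesis
      unfolding ennreal_of_nat_eq_real_of_nat
      by (subst (1 2) ennreal_mult[symmetric]) (simp_all del: of_nat_Suc)
  qed
  have "(\<integral>\<^sup>+\<omega>. \<psi> (N A \<omega>) * N A \<omega> \<partial>M) = (\<Sum>k. \<psi> (of_nat k) * of_nat k * ennreal (?p k))"
    using nn_integral_N[OF A, of "\<lambda>y. \<psi> y * y"] by simp
  also have "\<dots> = (\<Sum>k. \<psi> (of_nat (Suc k)) * of_nat (Suc k) * ennreal (?p (Suc k)))"
    using suminf_offset[of "\<lambda>k. \<psi> (of_nat k) * of_nat k * ennreal (?p k)" 1]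
    by simp
  also have "\<dots> = (\<Sum>k. ennreal ?l * (\<psi> (of_nat k + 1) * ennreal (?p k)))"
  proof (rule suminf_cong)
    fix k
    have "\<psi> (of_nat (Suc k)) * of_nat (Suc k) * ennreal (?p (Suc k)) =
        \<psi> (of_nat (Suc k)) * (of_nat (Suc k) * ennreal (?p (Suc k)))"
      by (rule mult.assoc)
    also have "\<dots> = ennreal ?l * (\<psi> (of_nat (Suc k)) * ennreal (?p k))"
      unfolding step by (rule mult.left_commute)
    also have "\<dots> = ennreal ?l * (\<psi> (of_nat k + 1) * ennreal (?p k))"
      by (simp add: add.commute)
    finally show "\<psi> (of_nat (Suc k)) * of_nat (Suc k) * ennreal (?p (Suc k)) =
        ennreal ?l * (\<psi> (of_nat k + 1) * ennreal (?p k))" .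
  qed
  also have "\<dots> = emeasure n A * (\<Sum>k. \<psi> (of_nat k + 1) * ennreal (?p k))"
    using A by (simp add: ennreal_suminf_cmult emeasure_eq_ennreal_measure)
  also have "(\<Sum>k. \<psi> (of_nat k + 1) * ennreal (?p k)) = (\<integral>\<^sup>+\<omega>. \<psi> (N A \<omega> + 1) \<partial>M)"
    using nn_integral_N[OF A, of "\<lambda>y. \<psi> (y + 1)"] by simp
  finally show ?thesis .
qed

lemma nn_integral_N_mean:
  assumes A: "A \<in> sets n" "emeasure n A < \<infinity>"
  shows "(\<integral>\<^sup>+\<omega>. N A \<omega> \<partial>M) = emeasure n A"
  using nn_integral_N_size_biased[OF A, of "\<lambda>_. 1"] by (simp add: emeasure_space_1)

lemma AE_N_empty: "AE \<omega> in M. N {} \<omega> = 0"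
proof -
  have "prob {\<omega> \<in> space M. N {} \<omega> = of_nat 0} = 1"
    using N_prob[of "{}" 0] by simp
  from AE_prob_1[OF this] show ?thesis by eventually_elim auto
qed

text \<open>
  Countable additivity is assumed for infinite sequences only; finite additivity follows by padding with
  empty sets, which have mass 0 almost surely.
\<close>
lemma AE_N_UN:
  assumes A: "range A \<subseteq> sets n" "disjoint_family (A :: nat \<Rightarrow> 's set)" and K: "finite K"
  shows "AE \<omega> in M. N (\<Union>k\<in>K. A k) \<omega> = (\<Sum>k\<in>K. N (A k) \<omega>)"
proof -
  define A' where "A' k = (if k \<in> K then A k else {})" for k
  have "range A' \<subseteq> sets n" "disjoint_family A'"
    using A by (auto simp: A'_def disjoint_family_on_def)
  from N_sigma_additive[OF this] AE_N_empty show ?thesis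
  proof eventually_elim
    case (elim \<omega>)
    have "(\<Union>k. A' k) = (\<Union>k\<in>K. A k)" by (auto simp: A'_def)
    moreover have "(\<Sum>k. N (A' k) \<omega>) = (\<Sum>k\<in>K. N (A' k) \<omega>)"
      using elim K by (intro suminf_finite) (auto simp: A'_def)
    moreover have "(\<Sum>k\<in>K. N (A' k) \<omega>) = (\<Sum>k\<in>K. N (A k) \<omega>)"
      by (rule sum.cong) (auto simp: A'_def)
    ultimately show ?case using elim by simp
  qed
qed

end

section \<open>Simple functions and cells of a partition\<close>

text \<open>
  A finite measurable partition is encoded by a simple function \<open>\<kappa>\<close> with values in the natural numbers,
  whose level sets are the cells; the index \<open>nat\<close> allows the cells to be used as a sequence of disjoint sets.
  Finitely many simple functions factor through one such \<open>\<kappa>\<close>: number the values of the tuple that they form.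
\<close>
lemma simple_function_common_refinement:
  fixes g :: "'i \<Rightarrow> 's \<Rightarrow> 'b"
  assumes I: "finite I" and g: "\<And>i. i \<in> I \<Longrightarrow> simple_function n (g i)"
  obtains \<kappa> :: "'s \<Rightarrow> nat" and c :: "'i \<Rightarrow> nat \<Rightarrow> 'b"
  where "simple_function n \<kappa>" "\<And>i s. i \<in> I \<Longrightarrow> s \<in> space n \<Longrightarrow> g i s = c i (\<kappa> s)"
proof -
  define F where "F s = (\<lambda>i\<in>I. g i s)" for s
  have fin: "finite (F ` space n)"
  proof (rule finite_subset)
    show "F ` space n \<subseteq> (\<Pi>\<^sub>E i\<in>I. g i ` space n)" by (auto simp: F_def)
    show "finite (\<Pi>\<^sub>E i\<in>I. g i ` space n)"
      using I g by (intro finite_PiE) (auto dest: simple_functionD)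
  qed
  have "simple_function n F"
    unfolding simple_function_def
  proof (intro conjI ballI fin)
    fix z assume "z \<in> F ` space n"
    then obtain s0 where z: "z = F s0" by auto
    have "F s = z \<longleftrightarrow> (\<forall>i\<in>I. g i s = z i)" for s
      unfolding z F_def fun_eq_iff by (metis restrict_apply)
    then have "F -` {z} \<inter> space n = {s \<in> space n. \<forall>i\<in>I. g i s = z i}"
      by auto
    also have "\<dots> \<in> sets n"
    proof (rule sets.sets_Collect_finite_All[OF _ I])
      fix i assume "i \<in> I"
      have "{s \<in> space n. g i s = z i} = g i -` {z i} \<inter> space n" by auto
      then show "{s \<in> space n. g i s = z i} \<in> sets n"
        using simple_functionD(2)[OF g[OF \<open>i \<in> I\<close>]] by simp
    qed
    finally show "F -` {z} \<inter> space n \<in> sets n" .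
  qed
  then have "simple_function n (\<lambda>s. to_nat_on (F ` space n) (F s))"
    by (rule simple_function_compose1)
  moreover have "g i s = from_nat_into (F ` space n) (to_nat_on (F ` space n) (F s)) i"
    if "i \<in> I" "s \<in> space n" for i s
    using that fin by (simp add: countable_finite F_def)
  ultimately show thesis
    by (rule that[of _ "\<lambda>i k. from_nat_into (F ` space n) k i"])
qed

lemma simple_function_refine_pair:
  fixes g g' :: "'s \<Rightarrow> 'b"
  assumes g: "simple_function n g" "simple_function n g'"
  shows "\<exists>(\<kappa> :: 's \<Rightarrow> nat) c c'. simple_function n \<kappa> \<and>
    (\<forall>s\<in>space n. g s = c (\<kappa> s) \<and> g' s = c' (\<kappa> s))"
proof -
  define h where "h b = (if b then g else g')" for b
  have h: "simple_function n (h b)" for b using g by (simp add: h_def)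
  show ?thesis
  proof (rule simple_function_common_refinement[of "UNIV :: bool set" n h])
    fix \<kappa> :: "'s \<Rightarrow> nat" and c
    assume *: "simple_function n \<kappa>" "\<And>b s. b \<in> UNIV \<Longrightarrow> s \<in> space n \<Longrightarrow> h b s = c b (\<kappa> s)"
    have "\<forall>s\<in>space n. g s = c True (\<kappa> s) \<and> g' s = c False (\<kappa> s)"
      using *(2)[of True] *(2)[of False] by (simp add: h_def)
    with *(1) show ?thesis by blast
  qed (use h in auto)
qed

lemma measurable_increment_component:
  assumes "j \<in> K"
  shows "(\<lambda>v. v(j := v j + 1)) \<in> measurable (PiM K (\<lambda>_. borel :: ennreal measure)) (PiM K (\<lambda>_. borel))"
proof (rule measurable_PiM_single')
  fix k assume "k \<in> K"
  then show "(\<lambda>v. (v(j := v j + 1)) k) \<in> borel_measurable (PiM K (\<lambda>_. borel :: ennreal measure))"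
    by (cases "k = j") auto
qed (use assms in \<open>auto simp: space_PiM PiE_iff extensional_def\<close>)

context poisson_noise
begin

abbreviation cell :: "('s \<Rightarrow> nat) \<Rightarrow> nat \<Rightarrow> 's set" where
  "cell \<kappa> k \<equiv> \<kappa> -` {k} \<inter> space n"

lemma cell_family:
  assumes "simple_function n \<kappa>"
  shows "range (cell \<kappa>) \<subseteq> sets n" "disjoint_family (cell \<kappa>)" "cell \<kappa> k \<in> sets n"
  using simple_functionD(2)[OF assms] by (auto simp: disjoint_family_on_def)

lemma AE_N_cells:
  assumes \<kappa>: "simple_function n \<kappa>"
  shows "AE \<omega> in M. N {s \<in> space n. P (\<kappa> s)} \<omega> = (\<Sum>k | k \<in> \<kappa> ` space n \<and> P k. N (cell \<kappa> k) \<omega>)"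
proof -
  have "{s \<in> space n. P (\<kappa> s)} = (\<Union>k\<in>{k. k \<in> \<kappa> ` space n \<and> P k}. cell \<kappa> k)"
    by auto
  then show ?thesis
    using AE_N_UN[OF cell_family(1,2)[OF \<kappa>], of "{k. k \<in> \<kappa> ` space n \<and> P k}"]
      simple_functionD(1)[OF \<kappa>] by simp
qed

lemma AE_N_levels:
  fixes g :: "'s \<Rightarrow> 'b" and c :: "nat \<Rightarrow> 'b"
  assumes \<kappa>: "simple_function n \<kappa>" and g: "\<And>s. s \<in> space n \<Longrightarrow> g s = c (\<kappa> s)"
  shows "AE \<omega> in M. \<forall>y\<in>g ` space n. N (g -` {y} \<inter> space n) \<omega> =
           (\<Sum>k\<in>{k \<in> \<kappa> ` space n. c k = y}. N (cell \<kappa> k) \<omega>)"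
proof -
  have img: "g ` space n = c ` \<kappa> ` space n" using g by force
  have "finite (g ` space n)"
    unfolding img using simple_functionD(1)[OF \<kappa>] by simp
  moreover have "AE \<omega> in M. N (g -` {y} \<inter> space n) \<omega> =
      (\<Sum>k\<in>{k \<in> \<kappa> ` space n. c k = y}. N (cell \<kappa> k) \<omega>)" for y
  proof -
    have "g -` {y} \<inter> space n = {s \<in> space n. c (\<kappa> s) = y}"
      using g by auto
    then show ?thesis
      using AE_N_cells[OF \<kappa>, of "\<lambda>k. c k = y"] by simp
  qed
  ultimately show ?thesis
    by (subst AE_finite_all) (assumption, blast)
qed

text \<open>
  The integral of a simple function is defined through its own level sets. Computing it on a finer partition
  makes integrals of different functions comparable, which gives their monotonicity and additivity.
\<close>
lemma prm_simple_cells: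
  assumes \<kappa>: "simple_function n \<kappa>" and g: "\<And>s. s \<in> space n \<Longrightarrow> g s = c (\<kappa> s)"
  shows "AE \<omega> in M. prm_simple n N g \<omega> = (\<Sum>k\<in>\<kappa> ` space n. c k * N (cell \<kappa> k) \<omega>)"
proof -
  have "AE \<omega> in M. \<forall>y\<in>g ` space n. N (g -` {y} \<inter> space n) \<omega> =
           (\<Sum>k\<in>{k \<in> \<kappa> ` space n. c k = y}. N (cell \<kappa> k) \<omega>)"
    using assms by (rule AE_N_levels)
  then show ?thesis
  proof eventually_elim
    case (elim \<omega>)
    have img: "g ` space n = c ` \<kappa> ` space n" using g by force
    have fin: "finite (\<kappa> ` space n)" using simple_functionD(1)[OF \<kappa>] .
    have "prm_simple n N g \<omega> =
        (\<Sum>y\<in>g ` space n. \<Sum>k\<in>{k \<in> \<kappa> ` space n. c k = y}. c k * N (cell \<kappa> k) \<omega>)"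
      unfolding prm_simple_def by (intro sum.cong) (auto simp: elim sum_distrib_left)
    also have "\<dots> = (\<Sum>k\<in>\<kappa> ` space n. c k * N (cell \<kappa> k) \<omega>)"
      by (rule sum.group) (use fin in \<open>auto simp: img\<close>)
    finally show ?case .
  qed
qed

text \<open>
  The integral of a real simple function without compensation. The sum runs over the same values as in
  \<open>prm_simple_compensated\<close>, so that the two differ by a constant. As \<open>enn2real\<close> maps \<open>\<infinity>\<close> to 0, this is an
  integral only where all level sets of nonzero values have finite mass; under \<open>simple_fin\<close> this is almost surely so.
\<close>
definition simple_integral_N :: "('s \<Rightarrow> real) \<Rightarrow> 'w \<Rightarrow> real" where
  "simple_integral_N g \<omega> = (\<Sum>y\<in>g ` space n - {0}. y * enn2real (N (g -` {y} \<inter> space n) \<omega>))"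

definition simple_fin :: "('s \<Rightarrow> real) \<Rightarrow> bool" where
  "simple_fin g \<longleftrightarrow> simple_function n g \<and> emeasure n {s \<in> space n. g s \<noteq> 0} < \<infinity>"

lemma simple_finD:
  assumes "simple_fin g"
  shows "simple_function n g" "finite (g ` space n)"
    "g -` A \<inter> space n \<in> sets n" "y \<noteq> 0 \<Longrightarrow> emeasure n (g -` {y} \<inter> space n) < \<infinity>"
proof -
  show g: "simple_function n g" using assms by (simp add: simple_fin_def)
  then show "finite (g ` space n)" "g -` A \<inter> space n \<in> sets n" by (auto dest: simple_functionD)
  assume "y \<noteq> 0"
  have eq: "{s \<in> space n. g s \<noteq> 0} = g -` (-{0}) \<inter> space n" by auto
  have "emeasure n (g -` {y} \<inter> space n) \<le> emeasure n {s \<in> space n. g s \<noteq> 0}"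
    using \<open>y \<noteq> 0\<close> simple_functionD(2)[OF g] by (intro emeasure_mono) (auto simp: eq)
  also have "\<dots> < \<infinity>" using assms by (simp add: simple_fin_def)
  finally show "emeasure n (g -` {y} \<inter> space n) < \<infinity>" .
qed

lemma simple_integral_N_measurable [measurable]:
  "simple_fin g \<Longrightarrow> simple_integral_N g \<in> borel_measurable M"
  unfolding simple_integral_N_def using simple_finD(3)[of g]
  by (intro borel_measurable_sum borel_measurable_times borel_measurable_const
      measurable_compose[OF N_measurable borel_measurable_enn2real]) auto

lemma simple_integral_N_cells:
  assumes g_fin: "simple_fin g"
    and \<kappa>: "simple_function n \<kappa>" and g: "\<And>s. s \<in> space n \<Longrightarrow> g s = c (\<kappa> s)"
  shows "AE \<omega> in M. simple_integral_N g \<omega> = (\<Sum>k\<in>\<kappa> ` space n. c k * enn2real (N (cell \<kappa> k) \<omega>))"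
proof -
  have img: "g ` space n = c ` \<kappa> ` space n" using g by force
  have fin: "finite (\<kappa> ` space n)" using simple_functionD(1)[OF \<kappa>] .
  have "AE \<omega> in M. \<forall>k\<in>{k\<in>\<kappa> ` space n. c k \<noteq> 0}. N (cell \<kappa> k) \<omega> < \<infinity>"
  proof (subst AE_finite_all)
    show "\<forall>k\<in>{k\<in>\<kappa> ` space n. c k \<noteq> 0}. AE \<omega> in M. N (cell \<kappa> k) \<omega> < \<infinity>"
    proof safe
      fix s assume s: "s \<in> space n" "c (\<kappa> s) \<noteq> 0"
      have "cell \<kappa> (\<kappa> s) \<subseteq> g -` {c (\<kappa> s)} \<inter> space n" using g by auto
      then have "emeasure n (cell \<kappa> (\<kappa> s)) \<le> emeasure n (g -` {c (\<kappa> s)} \<inter> space n)"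
        by (rule emeasure_mono) (rule simple_finD(3)[OF g_fin])
      also have "\<dots> < \<infinity>" by (rule simple_finD(4)[OF g_fin s(2)])
      finally show "AE \<omega> in M. N (cell \<kappa> (\<kappa> s)) \<omega> < \<infinity>"
        by (intro AE_N_finite cell_family \<kappa>)
    qed
  qed (use fin in auto)
  moreover have "AE \<omega> in M. \<forall>y\<in>g ` space n. N (g -` {y} \<inter> space n) \<omega> =
           (\<Sum>k\<in>{k \<in> \<kappa> ` space n. c k = y}. N (cell \<kappa> k) \<omega>)"
    using \<kappa> g by (rule AE_N_levels)
  ultimately show ?thesis
  proof eventually_elim
    case (elim \<omega>)
    have "simple_integral_N g \<omega> =
        (\<Sum>y\<in>g ` space n - {0}. \<Sum>k\<in>{k \<in> \<kappa> ` space n - {k. c k = 0}. c k = y}. c k * enn2real (N (cell \<kappa> k) \<omega>))"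
      unfolding simple_integral_N_def
    proof (intro sum.cong refl)
      fix y assume y: "y \<in> g ` space n - {0}"
      have "enn2real (N (g -` {y} \<inter> space n) \<omega>) =
          (\<Sum>k\<in>{k \<in> \<kappa> ` space n. c k = y}. enn2real (N (cell \<kappa> k) \<omega>))"
      proof -
        have "N (g -` {y} \<inter> space n) \<omega> = (\<Sum>k\<in>{k \<in> \<kappa> ` space n. c k = y}. N (cell \<kappa> k) \<omega>)"
          using elim(2) y by blast
        also have "enn2real \<dots> = (\<Sum>k\<in>{k \<in> \<kappa> ` space n. c k = y}. enn2real (N (cell \<kappa> k) \<omega>))"
          using elim(1) y by (subst enn2real_sum) (auto simp: less_top)
        finally show ?thesis .
      qed
      also have "{k \<in> \<kappa> ` space n. c k = y} = {k \<in> \<kappa> ` space n - {k. c k = 0}. c k = y}"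
        using y by auto
      finally show "y * enn2real (N (g -` {y} \<inter> space n) \<omega>) =
         (\<Sum>k\<in>{k \<in> \<kappa> ` space n - {k. c k = 0}. c k = y}. c k * enn2real (N (cell \<kappa> k) \<omega>))"
        by (simp add: sum_distrib_left)
    qed
    also have "\<dots> = (\<Sum>k\<in>\<kappa> ` space n - {k. c k = 0}. c k * enn2real (N (cell \<kappa> k) \<omega>))"
      by (rule sum.group) (use fin in \<open>auto simp: img\<close>)
    also have "\<dots> = (\<Sum>k\<in>\<kappa> ` space n. c k * enn2real (N (cell \<kappa> k) \<omega>))"
      by (rule sum.mono_neutral_left) (use fin in auto)
    finally show ?case .
  qed
qed

section \<open>Mecke's formula for simple functions\<close>

text \<open>
  Independence makes the joint law of the masses a product, so the formula for one set can be applied to the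
  coordinate \<open>j\<close> while the other ones are held fixed.
\<close>
lemma nn_integral_PiM_cells_size_biased:
  assumes A: "range A \<subseteq> sets n" "disjoint_family (A :: nat \<Rightarrow> 's set)"
    and K: "finite K" "j \<in> K" and j: "emeasure n (A j) < \<infinity>"
    and \<Phi>: "\<Phi> \<in> borel_measurable (PiM K (\<lambda>_. borel))"
  shows "(\<integral>\<^sup>+v. \<Phi> v * v j \<partial>PiM K (\<lambda>k. distr M borel (N (A k)))) =
         emeasure n (A j) * (\<integral>\<^sup>+v. \<Phi> (v(j := v j + 1)) \<partial>PiM K (\<lambda>k. distr M borel (N (A k))))"
proof -
  have Am [measurable]: "A k \<in> sets n" for k using A by auto
  define L where "L k = distr M borel (N (A k))" for k
  have [measurable_cong, simp]: "sets (L k) = sets borel" for k by (simp add: L_def)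
  interpret L: prob_space "L k" for k unfolding L_def by (rule prob_space_distr) measurable
  interpret product_prob_space L ..
  define K' where "K' = K - {j}"
  have K': "finite K'" "j \<notin> K'" "K = insert j K'" using K by (auto simp: K'_def)
  have setsL: "sets (PiM K L) = sets (PiM K (\<lambda>_. borel))" by (intro sets_PiM_cong) auto
  have eqL: "borel_measurable (PiM (insert j K') L) = (borel_measurable (PiM K (\<lambda>_. borel)) :: (_ \<Rightarrow> ennreal) set)"
    using measurable_cong_sets[OF setsL refl] K'(3) by simp
  have [measurable]: "\<Phi> \<in> borel_measurable (PiM (insert j K') L)"
    unfolding eqL by (rule \<Phi>)
  have "(\<lambda>v. \<Phi> (v(j := v j + 1))) \<in> borel_measurable (PiM K (\<lambda>_. borel))"
    by (rule measurable_compose[OF measurable_increment_component[OF K(2)] \<Phi>])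
  then have [measurable]: "(\<lambda>v. \<Phi> (v(j := v j + 1))) \<in> borel_measurable (PiM (insert j K') L)"
    unfolding eqL .
  have upd: "(\<lambda>y. \<Phi> (x(j := y))) \<in> borel_measurable borel" if "x \<in> space (PiM K' L)" for x
  proof -
    have "(\<lambda>y. x(j := y)) \<in> measurable (L j) (PiM (insert j K') L)"
      using that K'(2) by (intro measurable_fun_upd[where J=K']) auto
    then show ?thesis
      by (auto dest: measurable_compose[where g=\<Phi>] simp: L_def)
  qed
  have "(\<integral>\<^sup>+v. \<Phi> v * v j \<partial>PiM K L) = (\<integral>\<^sup>+x. \<integral>\<^sup>+y. \<Phi> (x(j := y)) * y \<partial>L j \<partial>PiM K' L)"
    unfolding K'(3) by (subst product_nn_integral_insert[OF K'(1,2)]) auto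
  also have "\<dots> = (\<integral>\<^sup>+x. emeasure n (A j) * (\<integral>\<^sup>+y. \<Phi> (x(j := y + 1)) \<partial>L j) \<partial>PiM K' L)"
  proof (rule nn_integral_cong)
    fix x assume "x \<in> space (PiM K' L)"
    note [measurable] = upd[OF this]
    have "(\<integral>\<^sup>+y. \<Phi> (x(j := y)) * y \<partial>L j) = (\<integral>\<^sup>+\<omega>. \<Phi> (x(j := N (A j) \<omega>)) * N (A j) \<omega> \<partial>M)"
      unfolding L_def by (subst nn_integral_distr) auto
    also have "\<dots> = emeasure n (A j) * (\<integral>\<^sup>+\<omega>. \<Phi> (x(j := N (A j) \<omega> + 1)) \<partial>M)"
      by (rule nn_integral_N_size_biased[OF Am j, of "\<lambda>y. \<Phi> (x(j := y))"]) measurable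
    also have "(\<integral>\<^sup>+\<omega>. \<Phi> (x(j := N (A j) \<omega> + 1)) \<partial>M) = (\<integral>\<^sup>+y. \<Phi> (x(j := y + 1)) \<partial>L j)"
      unfolding L_def
      by (subst nn_integral_distr[where f="\<lambda>y. \<Phi> (x(j := y + 1))"])
         (auto intro!: measurable_compose[OF _ upd[OF \<open>x \<in> _\<close>]])
    finally show "(\<integral>\<^sup>+y. \<Phi> (x(j := y)) * y \<partial>L j) =
        emeasure n (A j) * (\<integral>\<^sup>+y. \<Phi> (x(j := y + 1)) \<partial>L j)" .
  qed
  also have "\<dots> = emeasure n (A j) * (\<integral>\<^sup>+x. (\<integral>\<^sup>+y. \<Phi> (x(j := y + 1)) \<partial>L j) \<partial>PiM K' L)"
    by (rule nn_integral_cmult)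
       (intro sigma_finite_measure.borel_measurable_nn_integral L.sigma_finite_measure_axioms, measurable)
  also have "(\<integral>\<^sup>+x. (\<integral>\<^sup>+y. \<Phi> (x(j := y + 1)) \<partial>L j) \<partial>PiM K' L) =
      (\<integral>\<^sup>+v. \<Phi> (v(j := v j + 1)) \<partial>PiM K L)"
    unfolding K'(3) by (subst product_nn_integral_insert[OF K'(1,2)]) auto
  finally show ?thesis unfolding L_def .
qed

end

lemma (in prob_space) indep_set_mono_right:
  "indep_set A B \<Longrightarrow> B' \<subseteq> B \<Longrightarrow> indep_set A B'"
  unfolding indep_sets2_eq by blast

text \<open>
  Independence is expressed by generated families of events, as the two random elements take values
  in different types.
\<close>
lemma (in prob_space) distr_Pair_eq_pair_measure:
  assumes [measurable]: "X \<in> measurable M S" "Y \<in> measurable M T"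
    and indep: "indep_set {X -` A \<inter> space M |A. A \<in> sets S} {Y -` B \<inter> space M |B. B \<in> sets T}"
  shows "distr M (S \<Otimes>\<^sub>M T) (\<lambda>\<omega>. (X \<omega>, Y \<omega>)) = distr M S X \<Otimes>\<^sub>M distr M T Y"
proof (rule pair_measure_eqI[symmetric])
  interpret X: prob_space "distr M S X" by (rule prob_space_distr) measurable
  interpret Y: prob_space "distr M T Y" by (rule prob_space_distr) measurable
  show "sigma_finite_measure (distr M S X)" "sigma_finite_measure (distr M T Y)" ..
  show "sets (distr M S X \<Otimes>\<^sub>M distr M T Y) = sets (distr M (S \<Otimes>\<^sub>M T) (\<lambda>\<omega>. (X \<omega>, Y \<omega>)))"
    by (simp cong: sets_pair_measure_cong)
  fix A B assume "A \<in> sets (distr M S X)" "B \<in> sets (distr M T Y)"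
  then have [measurable]: "A \<in> sets S" "B \<in> sets T" by auto
  have "(\<lambda>\<omega>. (X \<omega>, Y \<omega>)) -` (A \<times> B) \<inter> space M = (X -` A \<inter> space M) \<inter> (Y -` B \<inter> space M)"
    by auto
  moreover have "prob ((X -` A \<inter> space M) \<inter> (Y -` B \<inter> space M)) =
      prob (X -` A \<inter> space M) * prob (Y -` B \<inter> space M)"
    by (rule indep_setD[OF indep]) auto
  ultimately show "emeasure (distr M S X) A * emeasure (distr M T Y) B =
      emeasure (distr M (S \<Otimes>\<^sub>M T) (\<lambda>\<omega>. (X \<omega>, Y \<omega>))) (A \<times> B)"
    by (simp add: emeasure_distr emeasure_eq_measure ennreal_mult)
qed

text \<open>
  \<open>G\<close> is a random element that is independent of the whole noise; for the main result it is the path of the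
  Gaussian process.
\<close>
locale poisson_noise_indep = poisson_noise M n N for M :: "'w measure" and n :: "'s measure" and N +
  fixes R :: "'z measure" and G :: "'w \<Rightarrow> 'z"
  assumes G_measurable [measurable]: "G \<in> measurable M R"
    and indep: "indep_set {G -` B \<inter> space M |B. B \<in> sets R}
      {(\<lambda>\<omega>. \<lambda>A\<in>sets n. N A \<omega>) -` B \<inter> space M |B. B \<in> sets (PiM (sets n) (\<lambda>_. borel))}"
begin

lemma distr_pair_cells:
  assumes A: "range A \<subseteq> sets n" "disjoint_family (A :: nat \<Rightarrow> 's set)" and K: "K \<noteq> {}"
  shows "distr M (R \<Otimes>\<^sub>M PiM K (\<lambda>_. borel)) (\<lambda>\<omega>. (G \<omega>, \<lambda>k\<in>K. N (A k) \<omega>)) =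
         distr M R G \<Otimes>\<^sub>M PiM K (\<lambda>k. distr M borel (N (A k)))"
proof -
  have Am [measurable]: "A k \<in> sets n" for k using A by auto
  let ?E = "PiM K (\<lambda>_. borel) :: (nat \<Rightarrow> ennreal) measure"
  have sub: "(\<lambda>v. \<lambda>k\<in>K. v (A k)) \<in> measurable (PiM (sets n) (\<lambda>_. borel)) ?E"
    by (intro measurable_restrict measurable_component_singleton Am)
  have "distr M (R \<Otimes>\<^sub>M ?E) (\<lambda>\<omega>. (G \<omega>, \<lambda>k\<in>K. N (A k) \<omega>)) =
      distr M R G \<Otimes>\<^sub>M distr M ?E (\<lambda>\<omega>. \<lambda>k\<in>K. N (A k) \<omega>)"
  proof (rule distr_Pair_eq_pair_measure)
    have "{(\<lambda>\<omega>. \<lambda>k\<in>K. N (A k) \<omega>) -` B \<inter> space M |B. B \<in> sets ?E} \<subseteq>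
      {(\<lambda>\<omega>. \<lambda>A\<in>sets n. N A \<omega>) -` B \<inter> space M |B. B \<in> sets (PiM (sets n) (\<lambda>_. borel))}"
    proof safe
      fix B assume B: "B \<in> sets ?E"
      let ?B = "(\<lambda>v. \<lambda>k\<in>K. v (A k)) -` B \<inter> space (PiM (sets n) (\<lambda>_. borel))"
      have "(\<lambda>\<omega>. \<lambda>k\<in>K. N (A k) \<omega>) -` B \<inter> space M = (\<lambda>\<omega>. \<lambda>A\<in>sets n. N A \<omega>) -` ?B \<inter> space M"
        using Am by (auto simp: space_PiM cong: restrict_cong)
      with measurable_sets[OF sub B]
      show "\<exists>B'. (\<lambda>\<omega>. \<lambda>k\<in>K. N (A k) \<omega>) -` B \<inter> space M = (\<lambda>\<omega>. \<lambda>A\<in>sets n. N A \<omega>) -` B' \<inter> space M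
          \<and> B' \<in> sets (PiM (sets n) (\<lambda>_. borel))"
        by blast
    qed
    from indep_set_mono_right[OF indep this]
    show "indep_set {G -` B \<inter> space M |B. B \<in> sets R}
        {(\<lambda>\<omega>. \<lambda>k\<in>K. N (A k) \<omega>) -` B \<inter> space M |B. B \<in> sets ?E}" .
  qed measurable
  also have "distr M ?E (\<lambda>\<omega>. \<lambda>k\<in>K. N (A k) \<omega>) = PiM K (\<lambda>k. distr M borel (N (A k)))"
  proof -
    have "indep_vars (\<lambda>_. borel) (\<lambda>k. N (A k)) K"
      by (rule indep_vars_subset[OF N_indep[OF A]]) simp
    then show ?thesis
      by (subst (asm) indep_vars_iff_distr_eq_PiM'[OF K]) measurable
  qed
  finally show ?thesis .
qed

lemma nn_integral_cells_size_biased: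
  assumes A: "range A \<subseteq> sets n" "disjoint_family (A :: nat \<Rightarrow> 's set)"
    and K: "finite K" "j \<in> K" and j: "emeasure n (A j) < \<infinity>"
    and \<Phi>: "\<Phi> \<in> borel_measurable (R \<Otimes>\<^sub>M PiM K (\<lambda>_. borel))"
  shows "(\<integral>\<^sup>+\<omega>. \<Phi> (G \<omega>, \<lambda>k\<in>K. N (A k) \<omega>) * N (A j) \<omega> \<partial>M) =
     emeasure n (A j) * (\<integral>\<^sup>+\<omega>. \<Phi> (G \<omega>, (\<lambda>k\<in>K. N (A k) \<omega>)(j := N (A j) \<omega> + 1)) \<partial>M)"
proof -
  have Am [measurable]: "A k \<in> sets n" for k using A by auto
  let ?P = "PiM K (\<lambda>k. distr M borel (N (A k)))"
  let ?E = "PiM K (\<lambda>_. borel) :: (nat \<Rightarrow> ennreal) measure"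
  let ?v = "\<lambda>\<omega>. \<lambda>k\<in>K. N (A k) \<omega>"
  have setsP: "sets ?P = sets ?E" by (intro sets_PiM_cong) auto
  have setsRP: "sets (distr M R G \<Otimes>\<^sub>M ?P) = sets (R \<Otimes>\<^sub>M ?E)"
    by (intro sets_pair_measure_cong setsP) simp
  interpret P: prob_space ?P
    by (intro prob_space_PiM prob_space_distr) measurable
  have pair: "(\<lambda>\<omega>. (G \<omega>, ?v \<omega>)) \<in> measurable M (R \<Otimes>\<^sub>M ?E)" by measurable
  have int: "(\<integral>\<^sup>+\<omega>. h (G \<omega>, ?v \<omega>) \<partial>M) = (\<integral>\<^sup>+z. (\<integral>\<^sup>+v. h (z, v) \<partial>?P) \<partial>distr M R G)"
    if h: "h \<in> borel_measurable (R \<Otimes>\<^sub>M ?E)" for h :: "_ \<Rightarrow> ennreal"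
  proof -
    have "(\<integral>\<^sup>+\<omega>. h (G \<omega>, ?v \<omega>) \<partial>M) = (\<integral>\<^sup>+x. h x \<partial>(distr M R G \<Otimes>\<^sub>M ?P))"
      using K pair h by (subst distr_pair_cells[OF A, symmetric]) (auto simp: nn_integral_distr)
    also have "\<dots> = (\<integral>\<^sup>+z. (\<integral>\<^sup>+v. h (z, v) \<partial>?P) \<partial>distr M R G)"
      using h measurable_cong_sets[OF setsRP refl] by (subst P.nn_integral_fst) auto
    finally show ?thesis .
  qed
  have inc: "(\<lambda>x. \<Phi> (fst x, (snd x)(j := snd x j + 1))) \<in> borel_measurable (R \<Otimes>\<^sub>M ?E)"
    using measurable_increment_component[OF K(2)]
    by (intro measurable_compose[OF _ \<Phi>] measurable_Pair measurable_fst
        measurable_compose[OF measurable_snd])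
  have comp: "(\<lambda>x. snd x j) \<in> borel_measurable (R \<Otimes>\<^sub>M ?E)"
    using K by measurable
  have "(\<integral>\<^sup>+\<omega>. \<Phi> (G \<omega>, ?v \<omega>) * N (A j) \<omega> \<partial>M) =
      (\<integral>\<^sup>+z. (\<integral>\<^sup>+v. \<Phi> (z, v) * v j \<partial>?P) \<partial>distr M R G)"
    using int[of "\<lambda>x. \<Phi> x * snd x j"] K \<Phi> comp by simp
  also have "\<dots> = (\<integral>\<^sup>+z. emeasure n (A j) * (\<integral>\<^sup>+v. \<Phi> (z, v(j := v j + 1)) \<partial>?P) \<partial>distr M R G)"
  proof (rule nn_integral_cong)
    fix z assume "z \<in> space (distr M R G)"
    then have "(\<lambda>v. \<Phi> (z, v)) \<in> borel_measurable ?E"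
      using measurable_Pair2[OF \<Phi>] by simp
    then show "(\<integral>\<^sup>+v. \<Phi> (z, v) * v j \<partial>?P) = emeasure n (A j) * (\<integral>\<^sup>+v. \<Phi> (z, v(j := v j + 1)) \<partial>?P)"
      by (rule nn_integral_PiM_cells_size_biased[OF A K j])
  qed
  also have "\<dots> = emeasure n (A j) * (\<integral>\<^sup>+z. (\<integral>\<^sup>+v. \<Phi> (z, v(j := v j + 1)) \<partial>?P) \<partial>distr M R G)"
  proof (rule nn_integral_cmult)
    have "(\<lambda>x. \<Phi> (fst x, (snd x)(j := snd x j + 1))) \<in> borel_measurable (distr M R G \<Otimes>\<^sub>M ?P)"
      using inc measurable_cong_sets[OF setsRP refl] by blast
    from P.borel_measurable_nn_integral_fst[OF this]
    show "(\<lambda>z. \<integral>\<^sup>+v. \<Phi> (z, v(j := v j + 1)) \<partial>?P) \<in> borel_measurable (distr M R G)"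
      by simp
  qed
  also have "(\<integral>\<^sup>+z. (\<integral>\<^sup>+v. \<Phi> (z, v(j := v j + 1)) \<partial>?P) \<partial>distr M R G) =
     (\<integral>\<^sup>+\<omega>. \<Phi> (G \<omega>, (?v \<omega>)(j := N (A j) \<omega> + 1)) \<partial>M)"
    using int[OF inc] K by simp
  finally show ?thesis .
qed

text \<open>
  On a partition that refines \<open>B\<close> and all \<open>g i\<close>, the variable \<open>N B\<close> is the sum of the masses of the cells
  inside \<open>B\<close>. Weighting with the mass of the cell \<open>k\<close> adds 1 to this mass, and this adds to each integral the
  constant value of \<open>g i\<close> on the cell, that is, \<open>g i s\<close> for every \<open>s\<close> in the cell.
\<close>
lemma nn_integral_simple_Mecke:
  fixes g :: "'i \<Rightarrow> 's \<Rightarrow> real"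
  assumes I: "finite I" and g: "\<And>i. i \<in> I \<Longrightarrow> simple_fin (g i)"
    and B: "B \<in> sets n" "emeasure n B < \<infinity>"
    and \<psi>: "\<psi> \<in> borel_measurable (R \<Otimes>\<^sub>M PiM I (\<lambda>_. borel))"
  shows "(\<integral>\<^sup>+\<omega>. \<psi> (G \<omega>, \<lambda>i\<in>I. simple_integral_N (g i) \<omega>) * N B \<omega> \<partial>M) =
    (\<integral>\<^sup>+s. (\<integral>\<^sup>+\<omega>. \<psi> (G \<omega>, \<lambda>i\<in>I. simple_integral_N (g i) \<omega> + g i s) \<partial>M) * indicator B s \<partial>n)"
proof -
  \<comment> \<open>The indicator of \<open>B\<close> joins the family as the member \<open>None\<close>; this makes \<open>B\<close> a union of cells.\<close>
  define g' where "g' = case_option (indicator B) g"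
  have "simple_function n (g' i)" if "i \<in> insert None (Some ` I)" for i
    using that g B by (auto simp: g'_def simple_fin_def)
  then obtain \<kappa> :: "'s \<Rightarrow> nat" and c' where \<kappa>: "simple_function n \<kappa>"
    and c': "\<And>i s. i \<in> insert None (Some ` I) \<Longrightarrow> s \<in> space n \<Longrightarrow> g' i s = c' i (\<kappa> s)"
    using simple_function_common_refinement[of "insert None (Some ` I)" n g'] I by auto
  define c where "c i = c' (Some i)" for i
  define b where "b k \<longleftrightarrow> c' None k = (1::real)" for k
  have c: "g i s = c i (\<kappa> s)" if "i \<in> I" "s \<in> space n" for i s
    using c'[of "Some i" s] that by (simp add: g'_def c_def)
  have b: "s \<in> B \<longleftrightarrow> b (\<kappa> s)" if "s \<in> space n" for s
    using c'[of None s] that by (auto simp: g'_def b_def indicator_def split: if_splits)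
  have B_eq: "B = {s \<in> space n. b (\<kappa> s)}"
    using b sets.sets_into_space[OF B(1)] by auto
  define K where "K = \<kappa> ` space n"
  have K: "finite K" unfolding K_def by (rule simple_functionD[OF \<kappa>])
  note cell = cell_family[OF \<kappa>]
  have fin: "emeasure n (cell \<kappa> k) < \<infinity>" if "b k" for k
  proof -
    have "emeasure n (cell \<kappa> k) \<le> emeasure n B"
      using that B(1) by (intro emeasure_mono) (auto simp: B_eq)
    then show ?thesis using B(2) by simp
  qed
  note [measurable] = cell(3) B(1)
  define S where "S v = (\<lambda>i\<in>I. \<Sum>k\<in>K. c i k * enn2real (v k))" for v :: "nat \<Rightarrow> ennreal"
  have S: "S \<in> measurable (PiM K (\<lambda>_. borel)) (PiM I (\<lambda>_. borel))"
    unfolding S_def by (intro measurable_restrict borel_measurable_sum borel_measurable_times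
        borel_measurable_const borel_measurable_enn2real measurable_component_singleton)
  define \<Phi> where "\<Phi> x = \<psi> (fst x, S (snd x))" for x
  have \<Phi>: "\<Phi> \<in> borel_measurable (R \<Otimes>\<^sub>M PiM K (\<lambda>_. borel))"
    unfolding \<Phi>_def
    by (intro measurable_compose[OF _ \<psi>] measurable_Pair measurable_fst measurable_compose[OF measurable_snd S])
  let ?v = "\<lambda>\<omega>. \<lambda>k\<in>K. N (cell \<kappa> k) \<omega>"
  let ?Y = "\<lambda>\<omega> i. simple_integral_N (g i) \<omega>"
  have Y: "AE \<omega> in M. \<forall>i\<in>I. ?Y \<omega> i = (\<Sum>k\<in>K. c i k * enn2real (N (cell \<kappa> k) \<omega>))"
  proof (subst AE_finite_all[OF I], safe)
    fix i assume "i \<in> I"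
    show "AE \<omega> in M. ?Y \<omega> i = (\<Sum>k\<in>K. c i k * enn2real (N (cell \<kappa> k) \<omega>))"
      unfolding K_def by (rule simple_integral_N_cells) (use g c \<kappa> \<open>i \<in> I\<close> in auto)
  qed
  have Y\<psi> [measurable]: "(\<lambda>\<omega>. \<psi> (G \<omega>, \<lambda>i\<in>I. ?Y \<omega> i + y i)) \<in> borel_measurable M" for y
    using g by (intro measurable_compose[OF _ \<psi>] measurable_Pair G_measurable measurable_restrict) measurable
  have v\<Phi> [measurable]: "(\<lambda>\<omega>. \<Phi> (G \<omega>, ?v \<omega>)) \<in> borel_measurable M"
    by (intro measurable_compose[OF _ \<Phi>] measurable_Pair G_measurable measurable_restrict) measurable
  have "(\<integral>\<^sup>+\<omega>. \<psi> (G \<omega>, \<lambda>i\<in>I. ?Y \<omega> i) * N B \<omega> \<partial>M) =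
      (\<integral>\<^sup>+\<omega>. (\<Sum>k\<in>{k\<in>K. b k}. \<Phi> (G \<omega>, ?v \<omega>) * N (cell \<kappa> k) \<omega>) \<partial>M)"
  proof (rule nn_integral_cong_AE)
    have "AE \<omega> in M. N B \<omega> = (\<Sum>k\<in>{k\<in>K. b k}. N (cell \<kappa> k) \<omega>)"
      unfolding B_eq K_def by (rule AE_N_cells[OF \<kappa>])
    with Y show "AE \<omega> in M. \<psi> (G \<omega>, \<lambda>i\<in>I. ?Y \<omega> i) * N B \<omega> =
        (\<Sum>k\<in>{k\<in>K. b k}. \<Phi> (G \<omega>, ?v \<omega>) * N (cell \<kappa> k) \<omega>)"
    proof eventually_elim
      case (elim \<omega>)
      have "S (?v \<omega>) = (\<lambda>i\<in>I. ?Y \<omega> i)"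
        using elim(1) by (auto simp: S_def fun_eq_iff)
      then show ?case using elim(2) by (simp add: \<Phi>_def sum_distrib_left)
    qed
  qed
  also have "\<dots> = (\<Sum>k\<in>{k\<in>K. b k}. \<integral>\<^sup>+\<omega>. \<Phi> (G \<omega>, ?v \<omega>) * N (cell \<kappa> k) \<omega> \<partial>M)"
    by (rule nn_integral_sum) measurable
  also have "\<dots> = (\<Sum>k\<in>{k\<in>K. b k}. emeasure n (cell \<kappa> k) * (\<integral>\<^sup>+\<omega>. \<psi> (G \<omega>, \<lambda>i\<in>I. ?Y \<omega> i + c i k) \<partial>M))"
  proof (rule sum.cong[OF refl], safe)
    fix j assume j: "j \<in> K" "b j"
    have "(\<integral>\<^sup>+\<omega>. \<Phi> (G \<omega>, ?v \<omega>) * N (cell \<kappa> j) \<omega> \<partial>M) =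
       emeasure n (cell \<kappa> j) * (\<integral>\<^sup>+\<omega>. \<Phi> (G \<omega>, (?v \<omega>)(j := N (cell \<kappa> j) \<omega> + 1)) \<partial>M)"
      by (rule nn_integral_cells_size_biased[OF cell(1,2) K j(1) fin[OF j(2)] \<Phi>])
    also have "(\<integral>\<^sup>+\<omega>. \<Phi> (G \<omega>, (?v \<omega>)(j := N (cell \<kappa> j) \<omega> + 1)) \<partial>M) =
        (\<integral>\<^sup>+\<omega>. \<psi> (G \<omega>, \<lambda>i\<in>I. ?Y \<omega> i + c i j) \<partial>M)"
    proof (rule nn_integral_cong_AE)
      show "AE \<omega> in M. \<Phi> (G \<omega>, (?v \<omega>)(j := N (cell \<kappa> j) \<omega> + 1)) = \<psi> (G \<omega>, \<lambda>i\<in>I. ?Y \<omega> i + c i j)"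
        using Y AE_N_finite[OF cell(3) fin[OF j(2)]]
      proof eventually_elim
        case (elim \<omega>)
        have "(\<Sum>k\<in>K. c i k * enn2real (((?v \<omega>)(j := N (cell \<kappa> j) \<omega> + 1)) k)) = ?Y \<omega> i + c i j"
          if "i \<in> I" for i
        proof -
          have "(\<Sum>k\<in>K. c i k * enn2real (((?v \<omega>)(j := N (cell \<kappa> j) \<omega> + 1)) k)) =
              (\<Sum>k\<in>K. c i k * enn2real (N (cell \<kappa> k) \<omega>) + (if k = j then c i j else 0))"
            using elim(2) by (intro sum.cong) (auto simp: enn2real_plus algebra_simps)
          also have "\<dots> = ?Y \<omega> i + c i j"
            using elim(1) that j K by (simp add: sum.distrib)
          finally show ?thesis .
        qed
        then have "S ((?v \<omega>)(j := N (cell \<kappa> j) \<omega> + 1)) = (\<lambda>i\<in>I. ?Y \<omega> i + c i j)"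
          unfolding S_def by (intro restrict_ext)
        then show ?case by (simp add: \<Phi>_def)
      qed
    qed
    finally show "(\<integral>\<^sup>+\<omega>. \<Phi> (G \<omega>, ?v \<omega>) * N (cell \<kappa> j) \<omega> \<partial>M) =
       emeasure n (cell \<kappa> j) * (\<integral>\<^sup>+\<omega>. \<psi> (G \<omega>, \<lambda>i\<in>I. ?Y \<omega> i + c i j) \<partial>M)" .
  qed
  also have "\<dots> = (\<integral>\<^sup>+s. (\<Sum>k\<in>{k\<in>K. b k}. (\<integral>\<^sup>+\<omega>. \<psi> (G \<omega>, \<lambda>i\<in>I. ?Y \<omega> i + c i k) \<partial>M) * indicator (cell \<kappa> k) s) \<partial>n)"
    by (subst nn_integral_sum) (auto simp: nn_integral_cmult_indicator cell(3) mult.commute[of "emeasure n _"])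
  also have "\<dots> = (\<integral>\<^sup>+s. (\<integral>\<^sup>+\<omega>. \<psi> (G \<omega>, \<lambda>i\<in>I. ?Y \<omega> i + g i s) \<partial>M) * indicator B s \<partial>n)"
  proof (rule nn_integral_cong)
    fix s assume s: "s \<in> space n"
    define H where "H k = (\<integral>\<^sup>+\<omega>. \<psi> (G \<omega>, \<lambda>i\<in>I. ?Y \<omega> i + c i k) \<partial>M)" for k
    have "(\<Sum>k\<in>{k\<in>K. b k}. H k * indicator (cell \<kappa> k) s) =
        (\<Sum>k\<in>{k\<in>K. b k}. if k = \<kappa> s then H k else 0)"
      using s by (intro sum.cong) auto
    also have "\<dots> = H (\<kappa> s) * indicator B s"
      using s K b by (auto simp: K_def)
    also have "H (\<kappa> s) = (\<integral>\<^sup>+\<omega>. \<psi> (G \<omega>, \<lambda>i\<in>I. ?Y \<omega> i + g i s) \<partial>M)"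
      unfolding H_def using c s by (intro nn_integral_cong arg_cong[where f=\<psi>]) (auto simp: fun_eq_iff)
    finally show "(\<Sum>k\<in>{k\<in>K. b k}. (\<integral>\<^sup>+\<omega>. \<psi> (G \<omega>, \<lambda>i\<in>I. ?Y \<omega> i + c i k) \<partial>M) * indicator (cell \<kappa> k) s) =
        (\<integral>\<^sup>+\<omega>. \<psi> (G \<omega>, \<lambda>i\<in>I. ?Y \<omega> i + g i s) \<partial>M) * indicator B s"
      unfolding H_def .
  qed
  finally show ?thesis .
qed

end

context poisson_noise
begin

section \<open>Integrals of nonnegative functions as weights\<close>

lemma AE_prm_simple_mono:
  assumes g: "simple_function n g" "simple_function n g'" and le: "\<And>s. s \<in> space n \<Longrightarrow> g s \<le> g' s"
  shows "AE \<omega> in M. prm_simple n N g \<omega> \<le> prm_simple n N g' \<omega>"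
proof -
  obtain \<kappa> :: "'s \<Rightarrow> nat" and c c' where \<kappa>: "simple_function n \<kappa>"
    and c: "\<forall>s\<in>space n. g s = c (\<kappa> s) \<and> g' s = c' (\<kappa> s)"
    using simple_function_refine_pair[OF g] by blast
  have c1: "g s = c (\<kappa> s)" and c2: "g' s = c' (\<kappa> s)" if "s \<in> space n" for s
    using c that by auto
  have "AE \<omega> in M. prm_simple n N g \<omega> = (\<Sum>k\<in>\<kappa> ` space n. c k * N (cell \<kappa> k) \<omega>)"
    using \<kappa> c1 by (rule prm_simple_cells)
  moreover have "AE \<omega> in M. prm_simple n N g' \<omega> = (\<Sum>k\<in>\<kappa> ` space n. c' k * N (cell \<kappa> k) \<omega>)"
    using \<kappa> c2 by (rule prm_simple_cells)
  ultimately show ?thesis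
  proof eventually_elim
    case (elim \<omega>)
    have "c k \<le> c' k" if "k \<in> \<kappa> ` space n" for k
      using that le c1 c2 by auto
    then show ?case
      unfolding elim by (intro sum_mono mult_right_mono) auto
  qed
qed

lemma prm_simple_measurable [measurable]:
  assumes "simple_function n g"
  shows "prm_simple n N g \<in> borel_measurable M"
proof -
  note [measurable] = simple_functionD(2)[OF assms]
  show ?thesis unfolding prm_simple_def by measurable
qed

lemma nn_integral_prm_simple:
  assumes [measurable]: "\<phi> \<in> borel_measurable M" "H \<in> borel_measurable n"
    and *: "\<And>B. B \<in> sets n \<Longrightarrow> emeasure n B < \<infinity> \<Longrightarrow>
        (\<integral>\<^sup>+\<omega>. \<phi> \<omega> * N B \<omega> \<partial>M) = (\<integral>\<^sup>+s. H s * indicator B s \<partial>n)"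
    and g: "simple_function n g" "(\<integral>\<^sup>+s. g s \<partial>n) < \<infinity>"
  shows "(\<integral>\<^sup>+\<omega>. \<phi> \<omega> * prm_simple n N g \<omega> \<partial>M) = (\<integral>\<^sup>+s. H s * g s \<partial>n)"
proof -
  have [measurable]: "g -` A \<inter> space n \<in> sets n" for A
    by (rule simple_functionD[OF g(1)])
  have [measurable]: "g \<in> borel_measurable n"
    by (rule borel_measurable_simple_function[OF g(1)])
  have fin: "finite (g ` space n)" by (rule simple_functionD[OF g(1)])
  have level: "emeasure n (g -` {y} \<inter> space n) < \<infinity>" if "y \<noteq> 0" for y
  proof -
    have "y * emeasure n (g -` {y} \<inter> space n) = (\<integral>\<^sup>+s. y * indicator (g -` {y} \<inter> space n) s \<partial>n)"
      by (subst nn_integral_cmult_indicator) auto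
    also have "\<dots> \<le> (\<integral>\<^sup>+s. g s \<partial>n)"
      by (intro nn_integral_mono) (auto simp: indicator_def)
    also have "\<dots> < \<infinity>" by (rule g)
    finally show ?thesis using that by (auto simp: ennreal_mult_less_top)
  qed
  have "(\<integral>\<^sup>+\<omega>. \<phi> \<omega> * prm_simple n N g \<omega> \<partial>M) =
      (\<integral>\<^sup>+\<omega>. (\<Sum>y\<in>g ` space n. y * (\<phi> \<omega> * N (g -` {y} \<inter> space n) \<omega>)) \<partial>M)"
    by (simp add: prm_simple_def sum_distrib_left mult.left_commute)
  also have "\<dots> = (\<Sum>y\<in>g ` space n. y * (\<integral>\<^sup>+\<omega>. \<phi> \<omega> * N (g -` {y} \<inter> space n) \<omega> \<partial>M))"
    by (subst nn_integral_sum) (auto simp: nn_integral_cmult)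
  also have "\<dots> = (\<Sum>y\<in>g ` space n. y * (\<integral>\<^sup>+s. H s * indicator (g -` {y} \<inter> space n) s \<partial>n))"
  proof (rule sum.cong[OF refl])
    fix y
    show "y * (\<integral>\<^sup>+\<omega>. \<phi> \<omega> * N (g -` {y} \<inter> space n) \<omega> \<partial>M) =
        y * (\<integral>\<^sup>+s. H s * indicator (g -` {y} \<inter> space n) s \<partial>n)"
      using *[of "g -` {y} \<inter> space n"] level[of y] by (cases "y = 0") auto
  qed
  also have "\<dots> = (\<integral>\<^sup>+s. (\<Sum>y\<in>g ` space n. y * (H s * indicator (g -` {y} \<inter> space n) s)) \<partial>n)"
    by (subst nn_integral_sum) (auto simp: nn_integral_cmult)
  also have "\<dots> = (\<integral>\<^sup>+s. H s * g s \<partial>n)"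
  proof (rule nn_integral_cong)
    fix s assume s: "s \<in> space n"
    have "(\<Sum>y\<in>g ` space n. y * (H s * indicator (g -` {y} \<inter> space n) s)) =
        (\<Sum>y\<in>g ` space n. if y = g s then H s * y else 0)"
      using s by (intro sum.cong) (auto simp: mult.commute)
    also have "\<dots> = H s * g s" using s fin by simp
    finally show "(\<Sum>y\<in>g ` space n. y * (H s * indicator (g -` {y} \<inter> space n) s)) = H s * g s" .
  qed
  finally show ?thesis .
qed

lemma AE_incseq_prm_simple:
  assumes "\<And>k. simple_function n (g k)" "incseq g"
  shows "AE \<omega> in M. incseq (\<lambda>k. prm_simple n N (g k) \<omega>)"
proof -
  have "AE \<omega> in M. \<forall>k. prm_simple n N (g k) \<omega> \<le> prm_simple n N (g (Suc k)) \<omega>"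
    unfolding AE_all_countable
    using assms by (intro allI AE_prm_simple_mono) (auto simp: incseq_def le_fun_def)
  then show ?thesis
    by eventually_elim (rule incseq_SucI, simp)
qed

text \<open>
  Any identity between \<open>\<phi>\<close> and \<open>H\<close> with weights \<open>N B\<close> and \<open>B\<close> extends to the weights \<open>Y\<close> and \<open>f\<close>, where \<open>Y\<close>
  is the integral of \<open>f\<close> with respect to the noise: both sides are linear in \<open>f\<close> and continuous along increasing
  sequences. With \<open>\<phi> = H = 1\<close> this is Campbell's formula for the mean.
\<close>
lemma nn_integral_prm_nn_integral:
  assumes [measurable]: "\<phi> \<in> borel_measurable M" "H \<in> borel_measurable n"
    and *: "\<And>B. B \<in> sets n \<Longrightarrow> emeasure n B < \<infinity> \<Longrightarrow>
        (\<integral>\<^sup>+\<omega>. \<phi> \<omega> * N B \<omega> \<partial>M) = (\<integral>\<^sup>+s. H s * indicator B s \<partial>n)"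
    and f: "prm_nn_integral M n N f Y" "(\<integral>\<^sup>+s. f s \<partial>n) < \<infinity>"
  shows "(\<integral>\<^sup>+\<omega>. \<phi> \<omega> * Y \<omega> \<partial>M) = (\<integral>\<^sup>+s. H s * f s \<partial>n)"
proof -
  obtain g where g: "\<And>k. simple_function n (g k)" "incseq g"
      "\<And>s. s \<in> space n \<Longrightarrow> (SUP k. g k s) = f s"
      "AE \<omega> in M. Y \<omega> = (SUP k. prm_simple n N (g k) \<omega>)"
    using f(1) unfolding prm_nn_integral_def by blast
  note [measurable] = prm_simple_measurable[OF g(1)]
  have [measurable]: "g k \<in> borel_measurable n" for k
    by (rule borel_measurable_simple_function[OF g(1)])
  have gf: "g k s \<le> f s" if "s \<in> space n" for k s
    using SUP_upper[of k UNIV "\<lambda>k. g k s"] g(3)[OF that] by simp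
  have gfin: "(\<integral>\<^sup>+s. g k s \<partial>n) < \<infinity>" for k
    using nn_integral_mono[of n "g k" f] gf f(2) by (meson order_le_less_trans)
  have "(\<integral>\<^sup>+\<omega>. \<phi> \<omega> * Y \<omega> \<partial>M) = (\<integral>\<^sup>+\<omega>. (SUP k. \<phi> \<omega> * prm_simple n N (g k) \<omega>) \<partial>M)"
    using g(4) by (intro nn_integral_cong_AE) (auto simp: SUP_mult_left_ennreal)
  also have "\<dots> = (SUP k. \<integral>\<^sup>+\<omega>. \<phi> \<omega> * prm_simple n N (g k) \<omega> \<partial>M)"
  proof (rule nn_integral_monotone_convergence_SUP_AE)
    fix k
    show "AE \<omega> in M. \<phi> \<omega> * prm_simple n N (g k) \<omega> \<le> \<phi> \<omega> * prm_simple n N (g (Suc k)) \<omega>"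
      using AE_incseq_prm_simple[OF g(1,2)]
      by eventually_elim (auto intro!: mult_left_mono simp: incseq_Suc_iff)
  qed measurable
  also have "\<dots> = (SUP k. \<integral>\<^sup>+s. H s * g k s \<partial>n)"
    by (intro SUP_cong refl nn_integral_prm_simple * g(1) gfin) measurable
  also have "\<dots> = (\<integral>\<^sup>+s. (SUP k. H s * g k s) \<partial>n)"
    using g(2) by (intro nn_integral_monotone_convergence_SUP[symmetric])
      (auto simp: incseq_def le_fun_def intro!: mult_left_mono)
  also have "\<dots> = (\<integral>\<^sup>+s. H s * f s \<partial>n)"
    by (intro nn_integral_cong) (simp add: g(3) flip: SUP_mult_left_ennreal)
  finally show ?thesis .
qed

lemma nn_integral_prm_nn_integral_mean:
  assumes "prm_nn_integral M n N f Y" "(\<integral>\<^sup>+s. f s \<partial>n) < \<infinity>"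
  shows "(\<integral>\<^sup>+\<omega>. Y \<omega> \<partial>M) = (\<integral>\<^sup>+s. f s \<partial>n)"
proof -
  have "(\<integral>\<^sup>+\<omega>. 1 * Y \<omega> \<partial>M) = (\<integral>\<^sup>+s. 1 * f s \<partial>n)"
    by (rule nn_integral_prm_nn_integral[OF _ _ _ assms]) (simp_all add: nn_integral_N_mean)
  then show ?thesis by simp
qed

section \<open>Functionals with a given increment\<close>

text \<open>
  Adding an atom at \<open>s\<close> changes the integral of a simple \<open>g\<close> by \<open>g s\<close>. The functional \<open>Y\<close> inherits from its
  approximations that it changes by \<open>h s\<close>. The constants \<open>c k\<close> do not react to an additional atom; they make
  room for compensators, which need not converge by themselves.
\<close>
definition has_increment :: "('w \<Rightarrow> real) \<Rightarrow> ('s \<Rightarrow> real) \<Rightarrow> bool" where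
  "has_increment Y h \<longleftrightarrow> Y \<in> borel_measurable M \<and> h \<in> borel_measurable n \<and>
     (\<exists>g c. (\<forall>k. simple_fin (g k)) \<and> (AE s in n. (\<lambda>k. g k s) \<longlonglongrightarrow> h s) \<and>
        (AE \<omega> in M. (\<lambda>k. simple_integral_N (g k) \<omega> + c k) \<longlonglongrightarrow> Y \<omega>))"

text \<open>
  Both sides of Mecke's formula are stable under bounded pointwise limits, with dominating functions
  \<open>N B\<close> on the left and the indicator of \<open>B\<close> on the right. Almost everywhere convergence suffices on
  both sides.
\<close>
lemma Mecke_limit:
  fixes u :: "nat \<Rightarrow> 'w \<Rightarrow> ennreal" and v :: "nat \<Rightarrow> 's \<Rightarrow> 'w \<Rightarrow> ennreal"
  assumes B: "B \<in> sets n" "emeasure n B < \<infinity>"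
    and [measurable]: "\<And>k. u k \<in> borel_measurable M" "u' \<in> borel_measurable M"
      "\<And>k. (\<lambda>(s, \<omega>). v k s \<omega>) \<in> borel_measurable (n \<Otimes>\<^sub>M M)" "(\<lambda>(s, \<omega>). v' s \<omega>) \<in> borel_measurable (n \<Otimes>\<^sub>M M)"
    and bound: "\<And>k \<omega>. u k \<omega> \<le> 1" "\<And>k s \<omega>. v k s \<omega> \<le> 1"
    and u: "AE \<omega> in M. (\<lambda>k. u k \<omega>) \<longlonglongrightarrow> u' \<omega>"
    and v: "AE s in n. AE \<omega> in M. (\<lambda>k. v k s \<omega>) \<longlonglongrightarrow> v' s \<omega>"
    and eq: "\<And>k. (\<integral>\<^sup>+\<omega>. u k \<omega> * N B \<omega> \<partial>M) = (\<integral>\<^sup>+s. (\<integral>\<^sup>+\<omega>. v k s \<omega> \<partial>M) * indicator B s \<partial>n)"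
  shows "(\<integral>\<^sup>+\<omega>. u' \<omega> * N B \<omega> \<partial>M) = (\<integral>\<^sup>+s. (\<integral>\<^sup>+\<omega>. v' s \<omega> \<partial>M) * indicator B s \<partial>n)"
proof -
  note [measurable] = B(1)
  have lim1: "(\<lambda>k. \<integral>\<^sup>+\<omega>. u k \<omega> * N B \<omega> \<partial>M) \<longlonglongrightarrow> (\<integral>\<^sup>+\<omega>. u' \<omega> * N B \<omega> \<partial>M)"
  proof (rule nn_integral_dominated_convergence[where w="N B"])
    show "AE \<omega> in M. u k \<omega> * N B \<omega> \<le> N B \<omega>" for k
      using mult_right_mono[OF bound(1)] by (intro AE_I2) fastforce
    show "(\<integral>\<^sup>+\<omega>. N B \<omega> \<partial>M) < \<infinity>" using nn_integral_N_mean[OF B] B by simp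
    show "AE \<omega> in M. (\<lambda>k. u k \<omega> * N B \<omega>) \<longlonglongrightarrow> u' \<omega> * N B \<omega>"
      using u AE_N_finite[OF B]
    proof eventually_elim
      case (elim \<omega>)
      have "u' \<omega> \<le> 1"
        using elim(1) bound(1) by (intro LIMSEQ_le_const2) auto
      then have "u' \<omega> < top" by (simp add: order_le_less_trans)
      then show ?case
        using tendsto_mult_ennreal[OF elim(1) tendsto_const[of "N B \<omega>"]] elim(2) by (auto simp: less_top)
    qed
  qed measurable
  have v_meas: "v' s \<in> borel_measurable M" "v k s \<in> borel_measurable M" if "s \<in> space n" for s k
    using that by measurable
  have lim2: "(\<lambda>k. \<integral>\<^sup>+s. (\<integral>\<^sup>+\<omega>. v k s \<omega> \<partial>M) * indicator B s \<partial>n) \<longlonglongrightarrow>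
      (\<integral>\<^sup>+s. (\<integral>\<^sup>+\<omega>. v' s \<omega> \<partial>M) * indicator B s \<partial>n)"
  proof (rule nn_integral_dominated_convergence[where w="indicator B"])
    have "(\<integral>\<^sup>+\<omega>. v k s \<omega> \<partial>M) \<le> 1" for k s
      using nn_integral_mono[of M "v k s" "\<lambda>_. 1"] bound by (simp add: emeasure_space_1)
    then show "AE s in n. (\<integral>\<^sup>+\<omega>. v k s \<omega> \<partial>M) * indicator B s \<le> indicator B s" for k
      by (intro AE_I2) (auto simp: indicator_def)
    show "(\<integral>\<^sup>+s. indicator B s \<partial>n) < \<infinity>" using B by simp
    show "AE s in n. (\<lambda>k. (\<integral>\<^sup>+\<omega>. v k s \<omega> \<partial>M) * indicator B s) \<longlonglongrightarrow> (\<integral>\<^sup>+\<omega>. v' s \<omega> \<partial>M) * indicator B s"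
      using v AE_space
    proof eventually_elim
      case (elim s)
      have "(\<lambda>k. \<integral>\<^sup>+\<omega>. v k s \<omega> \<partial>M) \<longlonglongrightarrow> (\<integral>\<^sup>+\<omega>. v' s \<omega> \<partial>M)"
        using elim bound v_meas
        by (intro nn_integral_dominated_convergence[where w="\<lambda>_. 1"]) (auto simp: emeasure_space_1)
      then show ?case by (cases "s \<in> B") auto
    qed
  qed measurable
  show ?thesis
    using lim2 by (intro LIMSEQ_unique[OF lim1[unfolded eq]])
qed

end

context poisson_noise_indep
begin

text \<open>
  Continuity of the factors is what allows to pass from the approximating simple integrals to \<open>Y i\<close>, since these
  converge only almost surely; products of functions of one coordinate are enough to separate laws.
\<close>
lemma nn_integral_continuous_Mecke:
  fixes Y :: "'i \<Rightarrow> 'w \<Rightarrow> real" and h :: "'i \<Rightarrow> 's \<Rightarrow> real" and \<zeta> :: "'i \<Rightarrow> 'z \<Rightarrow> real"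
  assumes I: "finite I" and Y: "\<And>i. i \<in> I \<Longrightarrow> has_increment (Y i) (h i)"
    and \<zeta>: "\<And>i. i \<in> I \<Longrightarrow> \<zeta> i \<in> borel_measurable R"
    and f: "\<And>i. i \<in> I \<Longrightarrow> continuous_on UNIV (f i)" "\<And>i x. 0 \<le> f i x" "\<And>i x. f i x \<le> (1::real)"
    and B: "B \<in> sets n" "emeasure n B < \<infinity>"
  shows "(\<integral>\<^sup>+\<omega>. ennreal (\<Prod>i\<in>I. f i (\<zeta> i (G \<omega>) + Y i \<omega>)) * N B \<omega> \<partial>M) =
    (\<integral>\<^sup>+s. (\<integral>\<^sup>+\<omega>. ennreal (\<Prod>i\<in>I. f i (\<zeta> i (G \<omega>) + (Y i \<omega> + h i s))) \<partial>M) * indicator B s \<partial>n)"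
proof -
  have "\<forall>i\<in>I. \<exists>g c. (\<forall>k. simple_fin (g k)) \<and> (AE s in n. (\<lambda>k. g k s) \<longlonglongrightarrow> h i s) \<and>
        (AE \<omega> in M. (\<lambda>k. simple_integral_N (g k) \<omega> + c k) \<longlonglongrightarrow> Y i \<omega>)"
    using Y by (auto simp: has_increment_def)
  then have "\<exists>g c. \<forall>i\<in>I. (\<forall>k. simple_fin (g i k)) \<and> (AE s in n. (\<lambda>k. g i k s) \<longlonglongrightarrow> h i s) \<and>
        (AE \<omega> in M. (\<lambda>k. simple_integral_N (g i k) \<omega> + c i k) \<longlonglongrightarrow> Y i \<omega>)"
    unfolding bchoice_iff .
  then obtain g c where g: "\<And>i k. i \<in> I \<Longrightarrow> simple_fin (g i k)"
    and gh: "\<And>i. i \<in> I \<Longrightarrow> AE s in n. (\<lambda>k. g i k s) \<longlonglongrightarrow> h i s"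
    and gY: "\<And>i. i \<in> I \<Longrightarrow> AE \<omega> in M. (\<lambda>k. simple_integral_N (g i k) \<omega> + c i k) \<longlonglongrightarrow> Y i \<omega>"
    by blast
  have [measurable]: "f i \<in> borel_measurable borel" if "i \<in> I" for i
    using f(1)[OF that] by (rule borel_measurable_continuous_onI)
  have [measurable]: "Y i \<in> borel_measurable M" "h i \<in> borel_measurable n" if "i \<in> I" for i
    using Y[OF that] by (auto simp: has_increment_def)
  have [measurable]: "g i k \<in> borel_measurable n" "simple_integral_N (g i k) \<in> borel_measurable M"
    if "i \<in> I" for i k
    using g[OF that] by (auto intro: borel_measurable_simple_function simple_finD)
  note [measurable] = \<zeta>
  have gh_all: "AE s in n. \<forall>i\<in>I. (\<lambda>k. g i k s) \<longlonglongrightarrow> h i s"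
    using gh by (simp add: AE_finite_all[OF I])
  have gY_all: "AE \<omega> in M. \<forall>i\<in>I. (\<lambda>k. simple_integral_N (g i k) \<omega> + c i k) \<longlonglongrightarrow> Y i \<omega>"
    using gY by (simp add: AE_finite_all[OF I])
  have le1: "ennreal (\<Prod>i\<in>I. f i (x i)) \<le> 1" for x
    using f(2,3) by (simp add: prod_le_1)
  have cont: "(\<lambda>k. ennreal (\<Prod>i\<in>I. f i (x k i))) \<longlonglongrightarrow> ennreal (\<Prod>i\<in>I. f i (y i))"
    if "\<And>i. i \<in> I \<Longrightarrow> (\<lambda>k. x k i) \<longlonglongrightarrow> y i" for x y
    using that f(1)
    by (intro tendsto_ennrealI tendsto_prod) (metis UNIV_I continuous_on_tendsto_compose eventuallyI)
  show ?thesis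
  proof (rule Mecke_limit[OF B, where
      u="\<lambda>k \<omega>. ennreal (\<Prod>i\<in>I. f i (\<zeta> i (G \<omega>) + (simple_integral_N (g i k) \<omega> + c i k)))" and
      v="\<lambda>k s \<omega>. ennreal (\<Prod>i\<in>I. f i (\<zeta> i (G \<omega>) + ((simple_integral_N (g i k) \<omega> + g i k s) + c i k)))"])
    fix k
    let ?\<psi> = "\<lambda>x. ennreal (\<Prod>i\<in>I. f i (\<zeta> i (fst x) + (snd x i + c i k)))"
    have "?\<psi> \<in> borel_measurable (R \<Otimes>\<^sub>M PiM I (\<lambda>_. borel))"
      by measurable
    from nn_integral_simple_Mecke[OF I g B this, of "\<lambda>i. i" "\<lambda>_. k"]
    show "(\<integral>\<^sup>+\<omega>. ennreal (\<Prod>i\<in>I. f i (\<zeta> i (G \<omega>) + (simple_integral_N (g i k) \<omega> + c i k))) * N B \<omega> \<partial>M) =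
      (\<integral>\<^sup>+s. (\<integral>\<^sup>+\<omega>. ennreal (\<Prod>i\<in>I. f i (\<zeta> i (G \<omega>) + ((simple_integral_N (g i k) \<omega> + g i k s) + c i k))) \<partial>M)
          * indicator B s \<partial>n)"
      by (simp cong: prod.cong)
  next
    show "AE \<omega> in M. (\<lambda>k. ennreal (\<Prod>i\<in>I. f i (\<zeta> i (G \<omega>) + (simple_integral_N (g i k) \<omega> + c i k))))
        \<longlonglongrightarrow> ennreal (\<Prod>i\<in>I. f i (\<zeta> i (G \<omega>) + Y i \<omega>))"
      using gY_all by eventually_elim (intro cont tendsto_intros, simp)
    show "AE s in n. AE \<omega> in M. (\<lambda>k. ennreal (\<Prod>i\<in>I. f i (\<zeta> i (G \<omega>) + ((simple_integral_N (g i k) \<omega> + g i k s) + c i k))))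
        \<longlonglongrightarrow> ennreal (\<Prod>i\<in>I. f i (\<zeta> i (G \<omega>) + (Y i \<omega> + h i s)))"
      using gh_all
    proof eventually_elim
      case (elim s)
      show ?case using gY_all
      proof eventually_elim
        case (elim \<omega>)
        have "(\<lambda>k. (simple_integral_N (g i k) \<omega> + c i k) + g i k s) \<longlonglongrightarrow> Y i \<omega> + h i s" if "i \<in> I" for i
          using elim \<open>\<forall>i\<in>I. (\<lambda>k. g i k s) \<longlonglongrightarrow> h i s\<close> that by (intro tendsto_add) auto
        then have lim: "(\<lambda>k. (simple_integral_N (g i k) \<omega> + g i k s) + c i k) \<longlonglongrightarrow> Y i \<omega> + h i s" if "i \<in> I" for i
          using that by (simp add: ac_simps)
        show ?case by (intro cont tendsto_add[OF tendsto_const] lim)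
      qed
    qed
  qed (use le1 in \<open>auto, measurable\<close>)
qed

end

section \<open>Mecke's formula for functionals of a path\<close>

definition upper_box :: "'i set \<Rightarrow> ('i \<Rightarrow> real) \<Rightarrow> ('i \<Rightarrow> real) set" where
  "upper_box J a = {x. \<forall>i\<in>J. a i < x i}"

text \<open>
  Boxes with finitely many constrained coordinates are stable under intersection and generate the cylindrical
  sigma-algebra, so two finite measures on the path space agree if they agree on them.
\<close>
lemma sets_cyl_upper_box:
  "sets (cyl UNIV) = sigma_sets UNIV {upper_box J a | J (a :: 'i \<Rightarrow> real). finite J}"
proof -
  let ?E = "\<lambda>_::'i. range greaterThan :: real set set"
  have "sets (cyl (UNIV :: 'i set)) = sets (\<Pi>\<^sub>M i\<in>UNIV. sigma UNIV (?E i))"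
    by (subst borel_Ioi) (rule refl)
  also have "\<dots> = sets (sigma (\<Pi>\<^sub>E i\<in>UNIV. UNIV)
      {{f\<in>(\<Pi>\<^sub>E i\<in>UNIV. UNIV). \<forall>i\<in>j. f i \<in> A i} | A j. j \<in> Collect finite \<and> A \<in> Pi j ?E})"
  proof (rule sets_PiM_sigma)
    have "(UNIV :: real set) = (\<Union>k::nat. {- real k<..})"
    proof (intro set_eqI iffI UNIV_I)
      fix x :: real
      obtain k :: nat where "- x < real k" using reals_Archimedean2 by blast
      then show "x \<in> (\<Union>k::nat. {- real k<..})" by (auto intro!: exI[of _ k])
    qed
    then show "\<exists>S\<subseteq>range greaterThan. countable S \<and> (UNIV :: real set) = \<Union>S"
      by (intro exI[of _ "range (\<lambda>k::nat. {- real k<..})"]) auto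
  qed auto
  also have "{{f\<in>(\<Pi>\<^sub>E i\<in>UNIV. UNIV). \<forall>i\<in>j. f i \<in> A i} | A j. j \<in> Collect finite \<and> A \<in> Pi j ?E} =
      {upper_box J a | J (a :: 'i \<Rightarrow> real). finite J}" (is "?P = ?Q")
  proof safe
    fix A :: "'i \<Rightarrow> real set" and j :: "'i set" assume j: "finite j" "A \<in> Pi j ?E"
    then have "\<forall>i\<in>j. \<exists>a. A i = {a<..}" by auto
    then obtain a where "\<forall>i\<in>j. A i = {a i<..}" by metis
    then have "{f\<in>(\<Pi>\<^sub>E i\<in>UNIV. UNIV). \<forall>i\<in>j. f i \<in> A i} = upper_box j a"
      by (auto simp: upper_box_def)
    then show "\<exists>J a. {f\<in>(\<Pi>\<^sub>E i\<in>UNIV. UNIV). \<forall>i\<in>j. f i \<in> A i} = upper_box J a \<and> finite J"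
      using j by blast
  next
    fix J :: "'i set" and a :: "'i \<Rightarrow> real" assume "finite J"
    then show "\<exists>A j. upper_box J a = {f\<in>(\<Pi>\<^sub>E i\<in>UNIV. UNIV). \<forall>i\<in>j. f i \<in> A i} \<and>
        j \<in> Collect finite \<and> A \<in> Pi j ?E"
      by (intro exI[of _ "\<lambda>i. {a i<..}"] exI[of _ J]) (auto simp: upper_box_def)
  qed
  finally show ?thesis by simp
qed

lemma Int_stable_upper_box: "Int_stable {upper_box J a | J (a :: 'i \<Rightarrow> real). finite J}"
proof (rule Int_stableI, safe)
  fix J J' :: "'i set" and a a' :: "'i \<Rightarrow> real" assume fin: "finite J" "finite J'"
  let ?a = "\<lambda>i. if i \<in> J \<inter> J' then max (a i) (a' i) else if i \<in> J then a i else a' i"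
  have "upper_box J a \<inter> upper_box J' a' = upper_box (J \<union> J') ?a"
    by (auto simp: upper_box_def)
  then show "\<exists>J'' a''. upper_box J a \<inter> upper_box J' a' = upper_box J'' a'' \<and> finite J''"
    using fin by blast
qed

lemma measure_eqI_upper_box:
  fixes \<mu> \<mu>' :: "('i \<Rightarrow> real) measure"
  assumes sets: "sets \<mu> = sets (cyl UNIV)" "sets \<mu>' = sets (cyl UNIV)"
    and fin: "emeasure \<mu> UNIV < \<infinity>"
    and eq: "\<And>J a. finite J \<Longrightarrow> emeasure \<mu> (upper_box J a) = emeasure \<mu>' (upper_box J a)"
  shows "\<mu> = \<mu>'"
proof (rule measure_eqI_generator_eq[OF Int_stable_upper_box])
  show "range (\<lambda>_::nat. UNIV) \<subseteq> {upper_box J a | J (a :: 'i \<Rightarrow> real). finite J}"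
    by (auto simp: upper_box_def intro!: exI[of _ "{}"])
  show "sets \<mu> = sigma_sets UNIV {upper_box J a | J (a :: 'i \<Rightarrow> real). finite J}"
    "sets \<mu>' = sigma_sets UNIV {upper_box J a | J (a :: 'i \<Rightarrow> real). finite J}"
    using sets by (simp_all add: sets_cyl_upper_box)
qed (use fin eq in auto)

lemma upper_box_sets [measurable]: "finite J \<Longrightarrow> upper_box J a \<in> sets (cyl UNIV)"
  unfolding sets_cyl_upper_box by (rule sigma_sets.Basic) blast

text \<open>Piecewise linear approximations of the indicator of a half line by continuous functions.\<close>
definition ramp :: "nat \<Rightarrow> real \<Rightarrow> real \<Rightarrow> real" where
  "ramp k a x = max 0 (min 1 (real k * (x - a)))"

lemma ramp_bounds: "0 \<le> ramp k a x" "ramp k a x \<le> 1" "continuous_on UNIV (ramp k a)"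
  by (auto simp: ramp_def[abs_def] intro!: continuous_intros)

lemma ramp_tendsto: "(\<lambda>k. ramp k a x) \<longlonglongrightarrow> indicator {a<..} x"
proof (cases "a < x")
  case True
  obtain m :: nat where m: "1 / (x - a) < real m" using reals_Archimedean2 by blast
  have "eventually (\<lambda>k. ramp k a x = indicator {a<..} x) sequentially"
    using eventually_ge_at_top[of m]
  proof eventually_elim
    case (elim k)
    have "1 < real m * (x - a)" using m True by (simp add: field_simps)
    also have "\<dots> \<le> real k * (x - a)" using elim True by (intro mult_right_mono) auto
    finally show ?case using True by (simp add: ramp_def)
  qed
  then show ?thesis by (rule tendsto_eventually)
next
  case False
  then have "real k * (x - a) \<le> 0" for k by (intro mult_nonneg_nonpos) auto
  then have "ramp k a x = indicator {a<..} x" for k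
    using False by (simp add: ramp_def min.coboundedI2)
  then show ?thesis by simp
qed

lemma ramp_prod_tendsto:
  "finite J \<Longrightarrow> (\<lambda>k. ennreal (\<Prod>i\<in>J. ramp k (a i) (x i))) \<longlonglongrightarrow> indicator (upper_box J a) x"
proof -
  assume J: "finite J"
  have "(\<lambda>k. ennreal (\<Prod>i\<in>J. ramp k (a i) (x i))) \<longlonglongrightarrow> ennreal (\<Prod>i\<in>J. indicator {a i<..} (x i))"
    by (intro tendsto_ennrealI tendsto_prod ramp_tendsto)
  also have "ennreal (\<Prod>i\<in>J. indicator {a i<..} (x i)) = indicator (upper_box J a) x"
  proof (cases "x \<in> upper_box J a")
    case True
    then show ?thesis by (simp add: upper_box_def)
  next
    case False
    then obtain i where "i \<in> J" "\<not> a i < x i" by (auto simp: upper_box_def)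
    then have "(\<Prod>i\<in>J. indicator {a i<..} (x i)) = (0 :: real)"
      using J by (intro prod_zero) (auto intro!: bexI[of _ i])
    with False show ?thesis by simp
  qed
  finally show ?thesis .
qed

context poisson_noise_indep
begin

text \<open>
  The paths satisfy \<open>Z i = \<zeta> i G + Y i\<close> only outside a null set that depends on \<open>i\<close>. This is no obstacle, because
  both sides, regarded as measures of \<open>F\<close>, are determined by finitely many coordinates at a time.
\<close>
lemma nn_integral_path_Mecke:
  fixes Z Y :: "'i \<Rightarrow> 'w \<Rightarrow> real" and h :: "'i \<Rightarrow> 's \<Rightarrow> real" and \<zeta> :: "'i \<Rightarrow> 'z \<Rightarrow> real"
  assumes Y: "\<And>i. has_increment (Y i) (h i)" and \<zeta>: "\<And>i. \<zeta> i \<in> borel_measurable R"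
    and Z [measurable]: "\<And>i. Z i \<in> borel_measurable M"
    and ZY: "\<And>i. AE \<omega> in M. Z i \<omega> = \<zeta> i (G \<omega>) + Y i \<omega>"
    and B: "B \<in> sets n" "emeasure n B < \<infinity>"
    and F: "F \<in> borel_measurable (cyl UNIV)"
  shows "(\<integral>\<^sup>+\<omega>. F (\<lambda>i. Z i \<omega>) * N B \<omega> \<partial>M) =
    (\<integral>\<^sup>+s. (\<integral>\<^sup>+\<omega>. F (\<lambda>i. Z i \<omega> + h i s) \<partial>M) * indicator B s \<partial>n)"
proof -
  have h [measurable]: "h i \<in> borel_measurable n" for i
    using Y[of i] by (simp add: has_increment_def)
  note [measurable] = B(1)
  have Zp [measurable]: "(\<lambda>\<omega> i. Z i \<omega>) \<in> measurable M (cyl UNIV)"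
    by (rule measurable_PiM_single') auto
  have Zhp [measurable]: "(\<lambda>x i. Z i (snd x) + h i (fst x)) \<in> measurable (n \<Otimes>\<^sub>M M) (cyl UNIV)"
    by (rule measurable_PiM_single') auto
  \<comment> \<open>The two sides are the integrals of \<open>F\<close> with respect to \<open>\<mu>\<close> and \<open>\<mu>'\<close>.\<close>
  define \<mu> where "\<mu> = distr (density M (N B)) (cyl UNIV) (\<lambda>\<omega> i. Z i \<omega>)"
  define \<mu>' where "\<mu>' = distr (density n (indicator B) \<Otimes>\<^sub>M M) (cyl UNIV) (\<lambda>x i. Z i (snd x) + h i (fst x))"
  have \<mu>: "(\<integral>\<^sup>+x. f x \<partial>\<mu>) = (\<integral>\<^sup>+\<omega>. f (\<lambda>i. Z i \<omega>) * N B \<omega> \<partial>M)"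
    if [measurable]: "f \<in> borel_measurable (cyl UNIV)" for f
    unfolding \<mu>_def by (simp add: nn_integral_distr nn_integral_density mult.commute)
  have \<mu>': "(\<integral>\<^sup>+x. f x \<partial>\<mu>') = (\<integral>\<^sup>+s. (\<integral>\<^sup>+\<omega>. f (\<lambda>i. Z i \<omega> + h i s) \<partial>M) * indicator B s \<partial>n)"
    if [measurable]: "f \<in> borel_measurable (cyl UNIV)" for f
  proof -
    have "(\<integral>\<^sup>+x. f x \<partial>\<mu>') = (\<integral>\<^sup>+x. f (\<lambda>i. Z i (snd x) + h i (fst x)) \<partial>(density n (indicator B) \<Otimes>\<^sub>M M))"
      unfolding \<mu>'_def by (rule nn_integral_distr) measurable
    also have "\<dots> = (\<integral>\<^sup>+s. (\<integral>\<^sup>+\<omega>. f (\<lambda>i. Z i \<omega> + h i s) \<partial>M) \<partial>density n (indicator B))"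
      by (subst nn_integral_fst[symmetric]) auto
    also have "\<dots> = (\<integral>\<^sup>+s. (\<integral>\<^sup>+\<omega>. f (\<lambda>i. Z i \<omega> + h i s) \<partial>M) * indicator B s \<partial>n)"
      by (subst nn_integral_density) (auto simp: mult.commute)
    finally show ?thesis .
  qed
  have "\<mu> = \<mu>'"
  proof (rule measure_eqI_upper_box)
    show "emeasure \<mu> UNIV < \<infinity>"
      using \<mu>[of "\<lambda>_. 1"] nn_integral_N_mean[OF B] B(2)
      by (simp add: \<mu>_def space_PiM)
    fix J :: "'i set" and a :: "'i \<Rightarrow> real" assume J: "finite J"
    note [measurable] = upper_box_sets[OF J, of a]
    have ZY_J: "AE \<omega> in M. \<forall>i\<in>J. Z i \<omega> = \<zeta> i (G \<omega>) + Y i \<omega>"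
      using ZY by (simp add: AE_finite_all[OF J])
    have [measurable]: "ramp k b \<in> borel_measurable borel" for k b
      by (intro borel_measurable_continuous_onI ramp_bounds)
    have "(\<integral>\<^sup>+\<omega>. indicator (upper_box J a) (\<lambda>i. Z i \<omega>) * N B \<omega> \<partial>M) =
      (\<integral>\<^sup>+s. (\<integral>\<^sup>+\<omega>. indicator (upper_box J a) (\<lambda>i. Z i \<omega> + h i s) \<partial>M) * indicator B s \<partial>n)"
    proof (rule Mecke_limit[OF B, where u="\<lambda>k \<omega>. ennreal (\<Prod>i\<in>J. ramp k (a i) (Z i \<omega>))"
        and v="\<lambda>k s \<omega>. ennreal (\<Prod>i\<in>J. ramp k (a i) (Z i \<omega> + h i s))"])
      fix k
      have "(\<integral>\<^sup>+\<omega>. ennreal (\<Prod>i\<in>J. ramp k (a i) (Z i \<omega>)) * N B \<omega> \<partial>M) =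
          (\<integral>\<^sup>+\<omega>. ennreal (\<Prod>i\<in>J. ramp k (a i) (\<zeta> i (G \<omega>) + Y i \<omega>)) * N B \<omega> \<partial>M)"
        using ZY_J by (intro nn_integral_cong_AE) auto
      also have "\<dots> = (\<integral>\<^sup>+s. (\<integral>\<^sup>+\<omega>. ennreal (\<Prod>i\<in>J. ramp k (a i) (\<zeta> i (G \<omega>) + (Y i \<omega> + h i s))) \<partial>M)
          * indicator B s \<partial>n)"
        by (rule nn_integral_continuous_Mecke[OF J Y \<zeta> _ _ _ B]) (rule ramp_bounds)+
      also have "\<dots> = (\<integral>\<^sup>+s. (\<integral>\<^sup>+\<omega>. ennreal (\<Prod>i\<in>J. ramp k (a i) (Z i \<omega> + h i s)) \<partial>M)
          * indicator B s \<partial>n)"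
        using ZY_J by (intro nn_integral_cong arg_cong2[where f="(*)"] nn_integral_cong_AE refl)
          (auto simp: add.assoc)
      finally show "(\<integral>\<^sup>+\<omega>. ennreal (\<Prod>i\<in>J. ramp k (a i) (Z i \<omega>)) * N B \<omega> \<partial>M) =
        (\<integral>\<^sup>+s. (\<integral>\<^sup>+\<omega>. ennreal (\<Prod>i\<in>J. ramp k (a i) (Z i \<omega> + h i s)) \<partial>M) * indicator B s \<partial>n)" .
    next
      have le: "ennreal (\<Prod>i\<in>J. ramp k (a i) (x i)) \<le> 1" for k x
        by (simp add: prod_le_1 ramp_bounds)
      show "ennreal (\<Prod>i\<in>J. ramp k (a i) (Z i \<omega>)) \<le> 1" for k \<omega> by (rule le)
      show "ennreal (\<Prod>i\<in>J. ramp k (a i) (Z i \<omega> + h i s)) \<le> 1" for k s \<omega> by (rule le)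
    qed (auto intro!: ramp_prod_tendsto[OF J] simp: split_beta')
    then show "emeasure \<mu> (upper_box J a) = emeasure \<mu>' (upper_box J a)"
      using \<mu>[of "indicator (upper_box J a)"] \<mu>'[of "indicator (upper_box J a)"]
      by (simp add: \<mu>_def \<mu>'_def upper_box_sets[OF J])
  qed (simp_all add: \<mu>_def \<mu>'_def)
  then show ?thesis
    using \<mu>[OF F] \<mu>'[OF F] by simp
qed

end

section \<open>Increments of stochastic integrals\<close>

lemma tendsto_enn2real_finite:
  assumes "(u \<longlongrightarrow> x) F" "x < \<infinity>"
  shows "((\<lambda>n. enn2real (u n)) \<longlongrightarrow> enn2real x) F"
  using assms by (intro tendsto_enn2real) (auto simp: ennreal_enn2real_if)

lemma nn_integral_square_AE_subseq:
  fixes u :: "nat \<Rightarrow> 'a \<Rightarrow> real"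
  assumes [measurable]: "\<And>k. u k \<in> borel_measurable M"
    and lim: "(\<lambda>k. \<integral>\<^sup>+x. ennreal ((u k x)\<^sup>2) \<partial>M) \<longlonglongrightarrow> 0"
  shows "\<exists>r. strict_mono r \<and> (AE x in M. (\<lambda>k. u (r k) x) \<longlonglongrightarrow> 0)"
proof -
  have "eventually (\<lambda>k. (\<integral>\<^sup>+x. ennreal ((u k x)\<^sup>2) \<partial>M) < 1) sequentially"
    using order_tendstoD(2)[OF lim, of 1] by simp
  \<comment> \<open>Finitely many of the integrals may be infinite; they are skipped.\<close>
  then obtain m where m: "\<And>k. k \<ge> m \<Longrightarrow> (\<integral>\<^sup>+x. ennreal ((u k x)\<^sup>2) \<partial>M) < 1"
    by (auto simp: eventually_sequentially)
  have int: "integrable M (\<lambda>x. (u (k + m) x)\<^sup>2)" for k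
    using m[of "k + m"] by (intro integrableI_bounded) (auto elim: order_less_trans)
  have "(\<lambda>k. enn2real (\<integral>\<^sup>+x. ennreal ((u (k + m) x)\<^sup>2) \<partial>M)) \<longlonglongrightarrow> enn2real 0"
    using LIMSEQ_ignore_initial_segment[OF lim, of m] by (intro tendsto_enn2real_finite) auto
  then have "(\<lambda>k. \<integral>x. norm ((u (k + m) x)\<^sup>2) \<partial>M) \<longlonglongrightarrow> 0"
    by (simp add: integral_eq_nn_integral)
  from tendsto_L1_AE_subseq[OF int this] obtain r :: "nat \<Rightarrow> nat"
    where r: "strict_mono r" "AE x in M. (\<lambda>k. (u (r k + m) x)\<^sup>2) \<longlonglongrightarrow> 0"
    by auto
  from r(2) have "AE x in M. (\<lambda>k. u (r k + m) x) \<longlonglongrightarrow> 0"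
  proof eventually_elim
    case (elim x)
    from tendsto_real_sqrt[OF elim] show ?case
      by (simp add: tendsto_rabs_zero_iff)
  qed
  moreover have "strict_mono (\<lambda>k. r k + m)"
    using r(1) by (simp add: strict_mono_def)
  ultimately show ?thesis by blast
qed

context poisson_noise
begin

lemma simple_fin_add: "simple_fin g \<Longrightarrow> simple_fin g' \<Longrightarrow> simple_fin (\<lambda>s. g s + g' s)"
proof -
  assume g: "simple_fin g" "simple_fin g'"
  then have [measurable]: "g \<in> borel_measurable n" "g' \<in> borel_measurable n"
    by (auto intro: borel_measurable_simple_function simple_finD)
  have "emeasure n {s \<in> space n. g s + g' s \<noteq> 0} \<le>
      emeasure n ({s \<in> space n. g s \<noteq> 0} \<union> {s \<in> space n. g' s \<noteq> 0})"
    by (intro emeasure_mono) auto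
  also have "\<dots> \<le> emeasure n {s \<in> space n. g s \<noteq> 0} + emeasure n {s \<in> space n. g' s \<noteq> 0}"
    by (intro emeasure_subadditive) auto
  also have "\<dots> < \<infinity>" using g by (simp add: simple_fin_def)
  finally show ?thesis using g by (auto simp: simple_fin_def)
qed

lemma simple_integral_N_add:
  assumes g: "simple_fin g" "simple_fin g'"
  shows "AE \<omega> in M. simple_integral_N (\<lambda>s. g s + g' s) \<omega> = simple_integral_N g \<omega> + simple_integral_N g' \<omega>"
proof -
  obtain \<kappa> :: "'s \<Rightarrow> nat" and c c' where \<kappa>: "simple_function n \<kappa>"
    and c: "\<forall>s\<in>space n. g s = c (\<kappa> s) \<and> g' s = c' (\<kappa> s)"
    using simple_function_refine_pair[OF simple_finD(1)[OF g(1)] simple_finD(1)[OF g(2)]] by blast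
  have c1: "g s = c (\<kappa> s)" and c2: "g' s = c' (\<kappa> s)" if "s \<in> space n" for s
    using c that by auto
  have c3: "g s + g' s = c (\<kappa> s) + c' (\<kappa> s)" if "s \<in> space n" for s
    using c1 c2 that by simp
  have "AE \<omega> in M. simple_integral_N g \<omega> = (\<Sum>k\<in>\<kappa> ` space n. c k * enn2real (N (cell \<kappa> k) \<omega>))"
    using g(1) \<kappa> c1 by (rule simple_integral_N_cells)
  moreover have "AE \<omega> in M. simple_integral_N g' \<omega> = (\<Sum>k\<in>\<kappa> ` space n. c' k * enn2real (N (cell \<kappa> k) \<omega>))"
    using g(2) \<kappa> c2 by (rule simple_integral_N_cells)
  moreover have "AE \<omega> in M. simple_integral_N (\<lambda>s. g s + g' s) \<omega> =
      (\<Sum>k\<in>\<kappa> ` space n. (c k + c' k) * enn2real (N (cell \<kappa> k) \<omega>))"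
    using simple_fin_add[OF g] \<kappa> c3 by (rule simple_integral_N_cells)
  ultimately show ?thesis
    by eventually_elim (simp add: sum.distrib algebra_simps)
qed

lemma simple_integral_N_uminus:
  assumes g: "simple_fin g"
  shows "simple_fin (\<lambda>s. - g s)" "simple_integral_N (\<lambda>s. - g s) \<omega> = - simple_integral_N g \<omega>"
proof -
  show "simple_fin (\<lambda>s. - g s)"
    using g simple_function_compose1[of n g uminus] by (auto simp: simple_fin_def)
  have img: "(\<lambda>s. - g s) ` space n - {0} = uminus ` (g ` space n - {0})" by force
  have level: "(\<lambda>s. - g s) -` {- y} = g -` {y}" for y by auto
  show "simple_integral_N (\<lambda>s. - g s) \<omega> = - simple_integral_N g \<omega>"
    unfolding simple_integral_N_def img by (subst sum.reindex) (simp_all add: level sum_negf)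
qed

lemma has_increment_add:
  assumes "has_increment Y h" "has_increment Y' h'"
  shows "has_increment (\<lambda>\<omega>. Y \<omega> + Y' \<omega>) (\<lambda>s. h s + h' s)"
proof -
  from assms obtain g c g' c' where g: "\<And>k. simple_fin (g k)" "\<And>k. simple_fin (g' k)"
    and lim: "AE s in n. (\<lambda>k. g k s) \<longlonglongrightarrow> h s" "AE s in n. (\<lambda>k. g' k s) \<longlonglongrightarrow> h' s"
      "AE \<omega> in M. (\<lambda>k. simple_integral_N (g k) \<omega> + c k) \<longlonglongrightarrow> Y \<omega>"
      "AE \<omega> in M. (\<lambda>k. simple_integral_N (g' k) \<omega> + c' k) \<longlonglongrightarrow> Y' \<omega>"
    unfolding has_increment_def by blast
  have "AE s in n. (\<lambda>k. g k s + g' k s) \<longlonglongrightarrow> h s + h' s"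
    using lim(1,2) by eventually_elim (rule tendsto_add)
  moreover have "AE \<omega> in M. (\<lambda>k. simple_integral_N (\<lambda>s. g k s + g' k s) \<omega> + (c k + c' k)) \<longlonglongrightarrow> Y \<omega> + Y' \<omega>"
  proof -
    have "AE \<omega> in M. \<forall>k. simple_integral_N (\<lambda>s. g k s + g' k s) \<omega> =
        simple_integral_N (g k) \<omega> + simple_integral_N (g' k) \<omega>"
      unfolding AE_all_countable using simple_integral_N_add[OF g] by blast
    with lim(3,4) show ?thesis
    proof eventually_elim
      case (elim \<omega>)
      have "(\<lambda>k. simple_integral_N (\<lambda>s. g k s + g' k s) \<omega> + (c k + c' k)) =
          (\<lambda>k. (simple_integral_N (g k) \<omega> + c k) + (simple_integral_N (g' k) \<omega> + c' k))"
        using elim(3) by auto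
      with tendsto_add[OF elim(1,2)] show ?case by simp
    qed
  qed
  ultimately show ?thesis
    using assms simple_fin_add[OF g] unfolding has_increment_def
    by (intro conjI exI[of _ "\<lambda>k s. g k s + g' k s"] exI[of _ "\<lambda>k. c k + c' k"]) auto
qed

lemma has_increment_uminus:
  assumes "has_increment Y h"
  shows "has_increment (\<lambda>\<omega>. - Y \<omega>) (\<lambda>s. - h s)"
proof -
  from assms obtain g c where g: "\<And>k. simple_fin (g k)"
    and lim: "AE s in n. (\<lambda>k. g k s) \<longlonglongrightarrow> h s" "AE \<omega> in M. (\<lambda>k. simple_integral_N (g k) \<omega> + c k) \<longlonglongrightarrow> Y \<omega>"
    unfolding has_increment_def by blast
  have "AE s in n. (\<lambda>k. - g k s) \<longlonglongrightarrow> - h s"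
    using lim(1) by eventually_elim (rule tendsto_minus)
  moreover have "AE \<omega> in M. (\<lambda>k. simple_integral_N (\<lambda>s. - g k s) \<omega> + - c k) \<longlonglongrightarrow> - Y \<omega>"
    using lim(2)
  proof eventually_elim
    case (elim \<omega>)
    from tendsto_minus[OF elim] show ?case by (simp add: simple_integral_N_uminus[OF g] algebra_simps)
  qed
  ultimately show ?thesis
    using assms simple_integral_N_uminus(1)[OF g] unfolding has_increment_def
    by (intro conjI exI[of _ "\<lambda>k s. - g k s"] exI[of _ "\<lambda>k. - c k"]) auto
qed

lemma has_increment_shift:
  assumes "has_increment Y h" "Y' \<in> borel_measurable M" "AE \<omega> in M. Y' \<omega> = Y \<omega> + d"
  shows "has_increment Y' h"
proof -
  from assms(1) obtain g c where g: "\<And>k. simple_fin (g k)"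
    and lim: "AE s in n. (\<lambda>k. g k s) \<longlonglongrightarrow> h s" "AE \<omega> in M. (\<lambda>k. simple_integral_N (g k) \<omega> + c k) \<longlonglongrightarrow> Y \<omega>"
    unfolding has_increment_def by blast
  have "AE \<omega> in M. (\<lambda>k. simple_integral_N (g k) \<omega> + (c k + d)) \<longlonglongrightarrow> Y' \<omega>"
    using lim(2) assms(3)
  proof eventually_elim
    case (elim \<omega>)
    from tendsto_add[OF elim(1) tendsto_const[of d]] show ?case by (simp add: elim(2) add.assoc)
  qed
  then show ?thesis
    using assms g lim unfolding has_increment_def
    by (intro conjI exI[of _ g] exI[of _ "\<lambda>k. c k + d"]) auto
qed

text \<open>
  Convergence in the second mean gives almost everywhere convergence along a subsequence, first for the integrands
  and then, along a further one, for the integrals. The compensators are the constants in the definition of the increment.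
\<close>
lemma has_increment_L2_compensated:
  assumes Y: "prm_L2_compensated M n N f Y" and f [measurable]: "f \<in> borel_measurable n"
  shows "has_increment Y f"
proof -
  from Y obtain g where [measurable]: "Y \<in> borel_measurable M"
    and g: "\<And>k. simple_fin (g k)"
    and gf: "(\<lambda>k. \<integral>\<^sup>+s. ennreal ((g k s - f s)\<^sup>2) \<partial>n) \<longlonglongrightarrow> 0"
    and gY: "(\<lambda>k. \<integral>\<^sup>+\<omega>. ennreal ((prm_simple_compensated n N (g k) \<omega> - Y \<omega>)\<^sup>2) \<partial>M) \<longlonglongrightarrow> 0"
    unfolding prm_L2_compensated_def simple_fin_def by blast
  have [measurable]: "g k \<in> borel_measurable n" "simple_integral_N (g k) \<in> borel_measurable M" for k
    using g by (auto intro: borel_measurable_simple_function simple_finD)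
  define c where "c k = - (\<Sum>y\<in>g k ` space n - {0}. y * measure n (g k -` {y} \<inter> space n))" for k
  have comp: "prm_simple_compensated n N (g k) = (\<lambda>\<omega>. simple_integral_N (g k) \<omega> + c k)" for k
    by (simp add: fun_eq_iff prm_simple_compensated_def simple_integral_N_def c_def
        right_diff_distrib sum_subtractf)
  obtain r where r: "strict_mono r" "AE s in n. (\<lambda>k. g (r k) s - f s) \<longlonglongrightarrow> 0"
    using nn_integral_square_AE_subseq[OF _ gf] by auto
  have "\<exists>r'. strict_mono r' \<and> (AE \<omega> in M. (\<lambda>k. prm_simple_compensated n N (g (r (r' k))) \<omega> - Y \<omega>) \<longlonglongrightarrow> 0)"
    using LIMSEQ_subseq_LIMSEQ[OF gY r(1)]
    by (intro nn_integral_square_AE_subseq) (auto simp: comp comp_def)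
  then obtain r' where r': "strict_mono r'"
    "AE \<omega> in M. (\<lambda>k. prm_simple_compensated n N (g (r (r' k))) \<omega> - Y \<omega>) \<longlonglongrightarrow> 0"
    by blast
  have "AE s in n. (\<lambda>k. g (r (r' k)) s) \<longlonglongrightarrow> f s"
    using r(2)
  proof eventually_elim
    case (elim s)
    from LIMSEQ_subseq_LIMSEQ[OF elim r'(1)] show ?case
      by (simp add: comp_def LIM_zero_iff)
  qed
  moreover have "AE \<omega> in M. (\<lambda>k. simple_integral_N (g (r (r' k))) \<omega> + c (r (r' k))) \<longlonglongrightarrow> Y \<omega>"
    using r'(2) by eventually_elim (simp add: comp LIM_zero_iff)
  ultimately show ?thesis
    unfolding has_increment_def using g
    by (intro conjI exI[of _ "\<lambda>k. g (r (r' k))"] exI[of _ "\<lambda>k. c (r (r' k))"]) auto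
qed

text \<open>
  Each of the two finiteness conditions makes the simple functions below \<open>f\<close> vanish outside a set of finite
  measure: the first one is met by the large jumps of the noise, the second one by the density \<open>q\<close>.
\<close>
lemma has_increment_nn_integral:
  assumes Y: "prm_nn_integral M n N f Y" and f [measurable]: "f \<in> borel_measurable n"
    and f_fin: "\<And>s. s \<in> space n \<Longrightarrow> f s < \<infinity>" "emeasure n {s \<in> space n. f s \<noteq> 0} < \<infinity> \<or> (\<integral>\<^sup>+s. f s \<partial>n) < \<infinity>"
    and Y_fin: "AE \<omega> in M. Y \<omega> < \<infinity>"
  shows "has_increment (\<lambda>\<omega>. enn2real (Y \<omega>)) (\<lambda>s. enn2real (f s))"
proof -
  obtain g where [measurable]: "Y \<in> borel_measurable M" and g: "\<And>k. simple_function n (g k)" "incseq g"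
      "\<And>s. s \<in> space n \<Longrightarrow> (SUP k. g k s) = f s"
      "AE \<omega> in M. Y \<omega> = (SUP k. prm_simple n N (g k) \<omega>)"
    using Y unfolding prm_nn_integral_def by blast
  have [measurable]: "g k \<in> borel_measurable n" for k
    by (rule borel_measurable_simple_function[OF g(1)])
  have gf: "g k s \<le> f s" if "s \<in> space n" for k s
    using SUP_upper[of k UNIV "\<lambda>k. g k s"] g(3)[OF that] by simp
  have g_fin: "g k s < \<infinity>" if "s \<in> space n" for k s
    using gf[OF that] f_fin(1)[OF that] by (rule order_le_less_trans)
  have g_lim: "(\<lambda>k. g k s) \<longlonglongrightarrow> f s" if "s \<in> space n" for s
    using LIMSEQ_SUP[of "\<lambda>k. g k s"] g(2,3) that by (simp add: incseq_def le_fun_def)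
  have simple: "simple_fin (\<lambda>s. enn2real (g k s))" for k
  proof -
    have "simple_function n (\<lambda>s. enn2real (g k s))"
      using g(1) by (rule simple_function_compose1)
    moreover have "emeasure n {s \<in> space n. g k s \<noteq> 0} < \<infinity>"
      using f_fin(2)
    proof
      assume "emeasure n {s \<in> space n. f s \<noteq> 0} < \<infinity>"
      moreover have "emeasure n {s \<in> space n. g k s \<noteq> 0} \<le> emeasure n {s \<in> space n. f s \<noteq> 0}"
        using gf by (intro emeasure_mono) (auto simp flip: zero_less_iff_neq_zero intro: less_le_trans)
      ultimately show ?thesis by (rule order_le_less_trans[rotated])
    next
      assume "(\<integral>\<^sup>+s. f s \<partial>n) < \<infinity>"
      moreover have "(\<integral>\<^sup>+s. g k s \<partial>n) \<le> (\<integral>\<^sup>+s. f s \<partial>n)" using gf by (rule nn_integral_mono)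
      ultimately have "(\<integral>\<^sup>+s. g k s \<partial>n) < \<infinity>" by (rule order_le_less_trans[rotated])
      from simple_function_finite_support[OF g(1) this] show ?thesis by (simp add: less_top)
    qed
    moreover have "{s \<in> space n. enn2real (g k s) \<noteq> 0} = {s \<in> space n. g k s \<noteq> 0}"
    proof -
      have "enn2real (g k s) \<noteq> 0 \<longleftrightarrow> g k s \<noteq> 0" if "s \<in> space n" for s
        using g_fin[OF that, of k] by (auto simp: enn2real_eq_0_iff)
      then show ?thesis by blast
    qed
    ultimately show ?thesis by (simp add: simple_fin_def)
  qed
  \<comment> \<open>Below a finite \<open>Y \<omega>\<close> all terms of the sum are finite, so that \<open>enn2real\<close> is additive on them.\<close>
  have eq: "AE \<omega> in M. Y \<omega> < \<infinity> \<longrightarrow> prm_simple n N (g k) \<omega> \<le> Y \<omega> \<longrightarrow>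
      simple_integral_N (\<lambda>s. enn2real (g k s)) \<omega> = enn2real (prm_simple n N (g k) \<omega>)" for k
  proof -
    obtain \<kappa> :: "'s \<Rightarrow> nat" and c where \<kappa>: "simple_function n \<kappa>"
      and c: "\<And>s. s \<in> space n \<Longrightarrow> g k s = c (\<kappa> s)"
      using simple_function_refine_pair[OF g(1)[of k] g(1)[of k]] by blast
    have fin: "finite (\<kappa> ` space n)" by (rule simple_functionD[OF \<kappa>])
    have "AE \<omega> in M. prm_simple n N (g k) \<omega> = (\<Sum>j\<in>\<kappa> ` space n. c j * N (cell \<kappa> j) \<omega>)"
      using \<kappa> c by (rule prm_simple_cells)
    moreover have "AE \<omega> in M. simple_integral_N (\<lambda>s. enn2real (g k s)) \<omega> =
        (\<Sum>j\<in>\<kappa> ` space n. enn2real (c j) * enn2real (N (cell \<kappa> j) \<omega>))"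
      by (rule simple_integral_N_cells[OF simple \<kappa>]) (simp add: c)
    ultimately show ?thesis
    proof eventually_elim
      case (elim \<omega>)
      show ?case
      proof safe
        assume "Y \<omega> < \<infinity>" "prm_simple n N (g k) \<omega> \<le> Y \<omega>"
        then have "(\<Sum>j\<in>\<kappa> ` space n. c j * N (cell \<kappa> j) \<omega>) < top"
          using elim(1) by (auto dest: order_le_less_trans)
        then have "c j * N (cell \<kappa> j) \<omega> < top" if "j \<in> \<kappa> ` space n" for j
          using member_le_sum[of j "\<kappa> ` space n" "\<lambda>j. c j * N (cell \<kappa> j) \<omega>"] fin that
          by (auto intro: order_le_less_trans)
        then show "simple_integral_N (\<lambda>s. enn2real (g k s)) \<omega> = enn2real (prm_simple n N (g k) \<omega>)"
          unfolding elim by (subst enn2real_sum) (auto simp: enn2real_mult)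
      qed
    qed
  qed
  have "AE s in n. (\<lambda>k. enn2real (g k s)) \<longlonglongrightarrow> enn2real (f s)"
    using g_lim f_fin(1) by (intro AE_I2 tendsto_enn2real_finite) auto
  moreover have "AE \<omega> in M. (\<lambda>k. simple_integral_N (\<lambda>s. enn2real (g k s)) \<omega> + 0) \<longlonglongrightarrow> enn2real (Y \<omega>)"
  proof -
    have "AE \<omega> in M. \<forall>k. Y \<omega> < \<infinity> \<longrightarrow> prm_simple n N (g k) \<omega> \<le> Y \<omega> \<longrightarrow>
      simple_integral_N (\<lambda>s. enn2real (g k s)) \<omega> = enn2real (prm_simple n N (g k) \<omega>)"
      unfolding AE_all_countable using eq by blast
    with Y_fin g(4) AE_incseq_prm_simple[OF g(1,2)] show ?thesis
    proof eventually_elim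
      case (elim \<omega>)
      have lim: "(\<lambda>k. prm_simple n N (g k) \<omega>) \<longlonglongrightarrow> Y \<omega>"
        using LIMSEQ_SUP[OF elim(3)] elim(2) by simp
      have "prm_simple n N (g k) \<omega> \<le> Y \<omega>" for k
        unfolding elim(2) by (rule SUP_upper) simp
      then have "simple_integral_N (\<lambda>s. enn2real (g k s)) \<omega> = enn2real (prm_simple n N (g k) \<omega>)" for k
        using elim(1,4) by blast
      then show ?case
        using tendsto_enn2real_finite[OF lim elim(1)] by simp
    qed
  qed
  ultimately show ?thesis
    unfolding has_increment_def using simple
    by (intro conjI exI[of _ "\<lambda>k s. enn2real (g k s)"] exI[of _ "\<lambda>_. 0"]) auto
qed

end

section \<open>Extended expectations\<close>

text \<open>
  Where \<open>a\<close> and \<open>b\<close> are not both infinite, the positive part \<open>p\<close> and the negative part \<open>m\<close> of \<open>a - b\<close> satisfy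
  \<open>a + m = b + p\<close>; this relation can be integrated without subtracting infinite values.
\<close>
lemma ext_value_diff:
  assumes [measurable]: "a \<in> borel_measurable M" "b \<in> borel_measurable M"
    and fin: "(\<integral>\<^sup>+x. a x \<partial>M) < \<infinity> \<or> (\<integral>\<^sup>+x. b x \<partial>M) < \<infinity>"
  shows "ext_value M (\<lambda>x. enn2ereal (a x) - enn2ereal (b x)) =
    enn2ereal (\<integral>\<^sup>+x. a x \<partial>M) - enn2ereal (\<integral>\<^sup>+x. b x \<partial>M)"
proof -
  define p where "p x = e2ennreal (enn2ereal (a x) - enn2ereal (b x))" for x
  define m where "m x = e2ennreal (- (enn2ereal (a x) - enn2ereal (b x)))" for x
  have [measurable]: "p \<in> borel_measurable M" "m \<in> borel_measurable M"
    unfolding p_def m_def by measurable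
  have "AE x in M. a x \<noteq> \<infinity> \<or> b x \<noteq> \<infinity>"
    using fin nn_integral_PInf_AE[of a M] nn_integral_PInf_AE[of b M] by (auto simp: less_top)
  then have "AE x in M. a x + m x = b x + p x \<and> p x \<le> a x \<and> m x \<le> b x"
  proof eventually_elim
    case (elim x)
    have real: "ennreal r + ennreal (s - r) = ennreal s + ennreal (r - s)" if "0 \<le> r" "0 \<le> s" for r s
      using that by (cases "r \<le> s") (simp_all add: ennreal_neg flip: ennreal_plus)
    show ?case
      using elim unfolding p_def m_def
      by (cases "a x"; cases "b x") (auto simp: real e2ennreal_neg e2ennreal_infty intro!: ennreal_leI)
  qed
  then have AE: "AE x in M. a x + m x = b x + p x" "AE x in M. p x \<le> a x" "AE x in M. m x \<le> b x"
    by auto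
  have "(\<integral>\<^sup>+x. a x \<partial>M) + (\<integral>\<^sup>+x. m x \<partial>M) = (\<integral>\<^sup>+x. b x \<partial>M) + (\<integral>\<^sup>+x. p x \<partial>M)"
    using nn_integral_cong_AE[OF AE(1)] by (simp add: nn_integral_add)
  moreover have "(\<integral>\<^sup>+x. p x \<partial>M) \<le> (\<integral>\<^sup>+x. a x \<partial>M)" "(\<integral>\<^sup>+x. m x \<partial>M) \<le> (\<integral>\<^sup>+x. b x \<partial>M)"
    using AE(2,3) by (auto intro: nn_integral_mono_AE)
  moreover have arith: "enn2ereal P - enn2ereal D = enn2ereal A - enn2ereal B"
    if "A + D = B + P" "P \<le> A" "D \<le> B" "A < \<infinity> \<or> B < \<infinity>" for A B P D :: ennreal
    using that
    by (cases A; cases B; cases P; cases D) (auto simp: ennreal_plus[symmetric] top_unique simp del: ennreal_plus)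
  ultimately show ?thesis
    using fin unfolding ext_value_def p_def m_def by blast
qed

text \<open>
  To identify an iterated expectation with an expectation it suffices to compare positive and negative parts, where
  everything is an integral of nonnegative functions.
\<close>
lemma ext_iterated_eq_ext_expectation:
  assumes M: "sigma_finite_measure M"
    and \<Phi> [measurable]: "(\<lambda>(s, \<omega>). \<Phi> s \<omega>) \<in> borel_measurable (n \<Otimes>\<^sub>M M)"
    and q [measurable]: "q \<in> borel_measurable n" and q_nonneg: "\<And>s. s \<in> space n \<Longrightarrow> 0 \<le> q s"
    and pos: "(\<integral>\<^sup>+s. (\<integral>\<^sup>+\<omega>. e2ennreal (\<Phi> s \<omega>) \<partial>M) * ennreal (q s) \<partial>n) = (\<integral>\<^sup>+\<omega>. e2ennreal (\<Psi> \<omega>) \<partial>M')"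
    and neg: "(\<integral>\<^sup>+s. (\<integral>\<^sup>+\<omega>. e2ennreal (- \<Phi> s \<omega>) \<partial>M) * ennreal (q s) \<partial>n) = (\<integral>\<^sup>+\<omega>. e2ennreal (- \<Psi> \<omega>) \<partial>M')"
  shows "ext_iterated n q M \<Phi> = ext_expectation M' \<Psi>"
proof -
  interpret M: sigma_finite_measure M by (rule M)
  define A where "A s = (\<integral>\<^sup>+\<omega>. e2ennreal (\<Phi> s \<omega>) \<partial>M)" for s
  define B where "B s = (\<integral>\<^sup>+\<omega>. e2ennreal (- \<Phi> s \<omega>) \<partial>M)" for s
  have [measurable]: "A \<in> borel_measurable n" "B \<in> borel_measurable n"
    unfolding A_def B_def by measurable
  have scale: "(enn2ereal x - enn2ereal y) * ereal r = enn2ereal (x * ennreal r) - enn2ereal (y * ennreal r)"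
    if "0 \<le> r" for x y :: ennreal and r
    using that
    by (cases x; cases y; cases "r = 0")
      (auto simp: times_ennreal.rep_eq left_diff_distrib)
  have "ext_value n (\<lambda>s. ext_value M (\<Phi> s) * ereal (q s)) =
      ext_value n (\<lambda>s. enn2ereal (A s * ennreal (q s)) - enn2ereal (B s * ennreal (q s)))"
  proof -
    have "ext_value M (\<Phi> s) * ereal (q s) = enn2ereal (A s * ennreal (q s)) - enn2ereal (B s * ennreal (q s))"
      if "s \<in> space n" for s
      unfolding ext_value_def A_def B_def by (rule scale[OF q_nonneg[OF that]])
    then show ?thesis
      unfolding ext_value_def[of n] by (simp cong: nn_integral_cong)
  qed
  also have "\<dots> = enn2ereal (\<integral>\<^sup>+s. A s * ennreal (q s) \<partial>n) - enn2ereal (\<integral>\<^sup>+s. B s * ennreal (q s) \<partial>n)"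
    if "(\<integral>\<^sup>+s. A s * ennreal (q s) \<partial>n) < \<infinity> \<or> (\<integral>\<^sup>+s. B s * ennreal (q s) \<partial>n) < \<infinity>"
    using that by (intro ext_value_diff) auto
  finally show ?thesis
    unfolding ext_iterated_def ext_expectation_def ext_value_def[of M'] pos[symmetric] neg[symmetric]
      A_def[symmetric] B_def[symmetric]
    by simp
qed

lemma ext_expectation_cong_AE:
  assumes "AE x in M. f x = g x"
  shows "ext_expectation M f = ext_expectation M g"
proof -
  have "(\<integral>\<^sup>+x. e2ennreal (f x) \<partial>M) = (\<integral>\<^sup>+x. e2ennreal (g x) \<partial>M)"
    "(\<integral>\<^sup>+x. e2ennreal (- f x) \<partial>M) = (\<integral>\<^sup>+x. e2ennreal (- g x) \<partial>M)"
    using assms by (auto intro!: nn_integral_cong_AE)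
  then show ?thesis
    by (simp add: ext_expectation_def ext_value_def)
qed

lemma e2ennreal_ereal_times: "e2ennreal (ereal x * enn2ereal r) = ennreal x * r"
proof (cases "0 \<le> x")
  case True
  then have "ereal x * enn2ereal r = enn2ereal (ennreal x * r)"
    by (simp add: times_ennreal.rep_eq)
  then show ?thesis by simp
next
  case False
  then have "ereal x * enn2ereal r \<le> 0"
    by (cases r) (auto simp: mult_nonpos_nonneg)
  with False show ?thesis by (simp add: e2ennreal_neg ennreal_neg)
qed

context poisson_noise
begin

section \<open>The formula with the weight \<open>N(q)\<close>\<close>

text \<open>
  If \<open>Y\<close> vanishes, then so does the mass of \<open>A k\<close>, the set where the \<open>k\<close>-th simple approximation of \<open>f\<close> is nonzero.
  This has probability \<open>exp (- n (A k))\<close>, and \<open>n (A k)\<close> increases to the measure of the set where \<open>f\<close> is positive.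
\<close>
lemma AE_prm_nn_integral_pos:
  assumes Y: "prm_nn_integral M n N f Y" and f [measurable]: "f \<in> borel_measurable n"
    and fin: "(\<integral>\<^sup>+s. f s \<partial>n) < \<infinity>" and inf: "emeasure n {s \<in> space n. f s > 0} = \<infinity>"
  shows "AE \<omega> in M. Y \<omega> > 0"
proof -
  obtain g where [measurable]: "Y \<in> borel_measurable M" and g: "\<And>k. simple_function n (g k)" "incseq g"
      "\<And>s. s \<in> space n \<Longrightarrow> (SUP k. g k s) = f s"
      "AE \<omega> in M. Y \<omega> = (SUP k. prm_simple n N (g k) \<omega>)"
    using Y unfolding prm_nn_integral_def by blast
  have [measurable]: "g k \<in> borel_measurable n" for k
    by (rule borel_measurable_simple_function[OF g(1)])
  have gf: "g k s \<le> f s" if "s \<in> space n" for k s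
    using SUP_upper[of k UNIV "\<lambda>k. g k s"] g(3)[OF that] by simp
  define A where "A k = {s \<in> space n. g k s \<noteq> 0}" for k
  have [measurable]: "A k \<in> sets n" for k unfolding A_def by measurable
  have A_fin: "emeasure n (A k) < \<infinity>" for k
  proof -
    have "(\<integral>\<^sup>+s. g k s \<partial>n) < \<infinity>"
      using nn_integral_mono[of n "g k" f] gf fin by (meson order_le_less_trans)
    from simple_function_finite_support[OF g(1) this] show ?thesis by (simp add: A_def less_top)
  qed
  have "(\<Union>k. A k) = {s \<in> space n. f s > 0}"
  proof -
    have "(\<exists>k. g k s \<noteq> 0) \<longleftrightarrow> f s > 0" if "s \<in> space n" for s
      unfolding g(3)[OF that, symmetric] less_SUP_iff by (simp add: zero_less_iff_neq_zero)
    then show ?thesis by (auto simp: A_def)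
  qed
  moreover have "incseq A"
    using g(2) by (auto simp: A_def incseq_def le_fun_def) (metis le_zero_eq)
  moreover have "range A \<subseteq> sets n" by auto
  ultimately have SUP: "(SUP k. emeasure n (A k)) = \<infinity>"
    using SUP_emeasure_incseq[of A n] inf by metis
  have zero: "AE \<omega> in M. Y \<omega> = 0 \<longrightarrow> N (A k) \<omega> = 0" for k
  proof -
    obtain \<kappa> :: "'s \<Rightarrow> nat" and c where \<kappa>: "simple_function n \<kappa>"
      and c: "\<And>s. s \<in> space n \<Longrightarrow> g k s = c (\<kappa> s)"
      using simple_function_refine_pair[OF g(1)[of k] g(1)[of k]] by blast
    have K: "finite (\<kappa> ` space n)" by (rule simple_functionD[OF \<kappa>])
    have "AE \<omega> in M. prm_simple n N (g k) \<omega> = (\<Sum>j\<in>\<kappa> ` space n. c j * N (cell \<kappa> j) \<omega>)"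
      using \<kappa> c by (rule prm_simple_cells)
    moreover have "AE \<omega> in M. N (A k) \<omega> = (\<Sum>j | j \<in> \<kappa> ` space n \<and> c j \<noteq> 0. N (cell \<kappa> j) \<omega>)"
      using AE_N_cells[OF \<kappa>, of "\<lambda>j. c j \<noteq> 0"] c by (simp add: A_def cong: conj_cong)
    ultimately show ?thesis
      using g(4)
    proof eventually_elim
      case (elim \<omega>)
      show ?case
      proof
        assume "Y \<omega> = 0"
        then have "prm_simple n N (g k) \<omega> = 0"
          using SUP_upper[of k UNIV "\<lambda>k. prm_simple n N (g k) \<omega>"] elim(3) by simp
        then have "\<forall>j\<in>\<kappa> ` space n. c j * N (cell \<kappa> j) \<omega> = 0"
          unfolding elim(1) by (subst (asm) sum_eq_0_iff[OF K])
        then show "N (A k) \<omega> = 0" unfolding elim(2) by (intro sum.neutral) auto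
      qed
    qed
  qed
  let ?p = "prob {\<omega> \<in> space M. Y \<omega> = 0}"
  have bound: "?p \<le> exp (- measure n (A k))" for k
  proof -
    have "?p \<le> prob {\<omega> \<in> space M. N (A k) \<omega> = of_nat 0}"
      using zero[of k] by (intro finite_measure_mono_AE) auto
    also have "\<dots> = exp (- measure n (A k))"
      using N_prob[of "A k" 0] A_fin[of k] by simp
    finally show ?thesis .
  qed
  have "?p = 0"
  proof (rule ccontr)
    assume "?p \<noteq> 0"
    then have p: "?p > 0" by (simp add: zero_less_measure_iff)
    \<comment> \<open>A set \<open>A k\<close> of measure above \<open>- ln ?p\<close> contradicts \<open>bound\<close>.\<close>
    have "ennreal (- ln ?p) < (SUP k. emeasure n (A k))" by (simp add: SUP)
    then obtain k where "ennreal (- ln ?p) < emeasure n (A k)" unfolding less_SUP_iff by auto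
    then have "- ln ?p < measure n (A k)"
      using A_fin[of k] by (cases "0 \<le> - ln ?p")
        (auto simp: emeasure_eq_ennreal_measure less_top ennreal_less_iff ennreal_neg)
    then have "exp (- measure n (A k)) < exp (ln ?p)" by simp
    also have "\<dots> = ?p" using p by simp
    finally show False using bound[of k] by simp
  qed
  then have "AE \<omega> in M. \<omega> \<notin> {\<omega> \<in> space M. Y \<omega> = 0}"
    by (subst prob_eq_0[symmetric]) auto
  with AE_space show ?thesis
    by eventually_elim (auto simp: zero_less_iff_neq_zero)
qed

text \<open>
  The integral is a compensated integral of the small values, minus and plus integrals of the two signs of the large
  values, and a constant. The increments of the first three add up to \<open>f\<close>, and the constant has increment 0. An increment
  is only attributed to a measurable version \<open>Y\<close> of \<open>J\<close>, since \<open>J\<close> itself is given up to a null set.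
\<close>
lemma has_increment_cutoff_integral:
  assumes "prm_cutoff_integral M n N chi f J"
  shows "\<exists>Y. has_increment Y f \<and> (AE \<omega> in M. J \<omega> = Y \<omega>)"
proof -
  let ?small = "\<lambda>s. if \<bar>f s\<bar> \<le> 1 then f s else 0" and ?large = "\<lambda>s. if \<bar>f s\<bar> > 1 then f s else 0"
  let ?d = "LINT s|n. f s * ((if \<bar>f s\<bar> \<le> 1 then 1 else 0) - chi (f s))"
  from assms obtain Y1 Y2 where f [measurable]: "f \<in> borel_measurable n"
    and f_fin: "(\<integral>\<^sup>+s. ennreal (min ((f s)\<^sup>2) 1) \<partial>n) < \<infinity>"
    and Y1: "prm_L2_compensated M n N ?small Y1" and Y2: "prm_real_integral M n N ?large Y2"
    and J: "AE \<omega> in M. J \<omega> = Y1 \<omega> + Y2 \<omega> + ?d"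
    unfolding prm_cutoff_integral_def by blast
  from Y2 obtain P Q where P: "prm_nn_integral M n N (\<lambda>s. ennreal (?large s)) P"
    and Q: "prm_nn_integral M n N (\<lambda>s. ennreal (- ?large s)) Q"
    and PQ: "AE \<omega> in M. P \<omega> < \<infinity> \<and> Q \<omega> < \<infinity> \<and> Y2 \<omega> = enn2real (P \<omega>) - enn2real (Q \<omega>)"
    unfolding prm_real_integral_def by blast
  have "emeasure n {s \<in> space n. \<bar>f s\<bar> > 1} = (\<integral>\<^sup>+s. indicator {s \<in> space n. \<bar>f s\<bar> > 1} s \<partial>n)"
    by simp
  also have "\<dots> \<le> (\<integral>\<^sup>+s. ennreal (min ((f s)\<^sup>2) 1) \<partial>n)"
  proof (rule nn_integral_mono)
    fix s assume "s \<in> space n"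
    have "1 \<le> (f s)\<^sup>2" if "\<bar>f s\<bar> > 1"
      using that one_le_power[of "\<bar>f s\<bar>" 2] by simp
    then show "indicator {s \<in> space n. \<bar>f s\<bar> > 1} s \<le> ennreal (min ((f s)\<^sup>2) 1)"
      by (auto simp: indicator_def min_def)
  qed
  finally have large_fin: "emeasure n {s \<in> space n. \<bar>f s\<bar> > 1} < \<infinity>"
    using f_fin by (rule order_le_less_trans)
  have support: "emeasure n {s \<in> space n. u s \<noteq> 0} < \<infinity>"
    if "\<And>s. u s \<noteq> 0 \<Longrightarrow> \<bar>f s\<bar> > 1" for u :: "'s \<Rightarrow> ennreal"
    using that by (intro order_le_less_trans[OF emeasure_mono large_fin]) auto
  have P_support: "emeasure n {s \<in> space n. ennreal (?large s) \<noteq> 0} < \<infinity>"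
    by (rule support[of "\<lambda>s. ennreal (?large s)"], rule ccontr, simp)
  have Q_support: "emeasure n {s \<in> space n. ennreal (- ?large s) \<noteq> 0} < \<infinity>"
    by (rule support[of "\<lambda>s. ennreal (- ?large s)"], rule ccontr, simp)
  have "has_increment Y1 ?small"
    using Y1 by (rule has_increment_L2_compensated) measurable
  moreover have "has_increment (\<lambda>\<omega>. enn2real (P \<omega>)) (\<lambda>s. enn2real (ennreal (?large s)))"
    by (rule has_increment_nn_integral[OF P _ _ disjI1[OF P_support]]) (use PQ in auto)
  moreover have "has_increment (\<lambda>\<omega>. enn2real (Q \<omega>)) (\<lambda>s. enn2real (ennreal (- ?large s)))"
    by (rule has_increment_nn_integral[OF Q _ _ disjI1[OF Q_support]]) (use PQ in auto)
  ultimately have "has_increment (\<lambda>\<omega>. Y1 \<omega> + (enn2real (P \<omega>) + - enn2real (Q \<omega>)))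
      (\<lambda>s. ?small s + (enn2real (ennreal (?large s)) + - enn2real (ennreal (- ?large s))))"
    by (intro has_increment_add has_increment_uminus)
  also have "(\<lambda>s. ?small s + (enn2real (ennreal (?large s)) + - enn2real (ennreal (- ?large s)))) = f"
  proof (rule ext)
    have "enn2real (ennreal x) + - enn2real (ennreal (- x)) = x" for x :: real
      by (cases "0 \<le> x") (simp_all add: ennreal_neg)
    then show "?small s + (enn2real (ennreal (?large s)) + - enn2real (ennreal (- ?large s))) = f s" for s
      by (simp split: if_split)
  qed
  finally have inc: "has_increment (\<lambda>\<omega>. Y1 \<omega> + (enn2real (P \<omega>) + - enn2real (Q \<omega>))) f"
    (is "has_increment ?Y f") .
  have "?Y \<in> borel_measurable M"
    using inc by (simp only: has_increment_def)
  then have "(\<lambda>\<omega>. ?Y \<omega> + ?d) \<in> borel_measurable M"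
    by (rule borel_measurable_add) simp
  with inc have "has_increment (\<lambda>\<omega>. ?Y \<omega> + ?d) f"
    by (rule has_increment_shift[of _ _ _ ?d]) simp
  moreover have "AE \<omega> in M. J \<omega> = ?Y \<omega> + ?d"
    using J PQ by eventually_elim simp
  ultimately show ?thesis by blast
qed

end

context poisson_noise_indep
begin

text \<open>
  Since \<open>N(q)\<close> is itself a functional of the noise, with increment \<open>q\<close>, the pair of the path and \<open>N(q)\<close> is a path
  over the index set \<open>'t option\<close>, with \<open>N(q)\<close> as the coordinate \<open>None\<close>. Mecke's formula for this longer path has weights
  \<open>N B\<close>, which are then replaced by \<open>N(q)\<close>.
\<close>
lemma nn_integral_weighted_Mecke:
  fixes X Y :: "'t \<Rightarrow> 'w \<Rightarrow> real" and V :: "'t \<Rightarrow> 's \<Rightarrow> real" and \<zeta> :: "'t \<Rightarrow> 'z \<Rightarrow> real"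
  assumes Y: "\<And>t. has_increment (Y t) (V t)" and \<zeta>: "\<And>t. \<zeta> t \<in> borel_measurable R"
    and X [measurable]: "\<And>t. X t \<in> borel_measurable M"
    and XY: "\<And>t. AE \<omega> in M. X t \<omega> = \<zeta> t (G \<omega>) + Y t \<omega>"
    and q [measurable]: "q \<in> borel_measurable n"
    and q_fin: "(\<integral>\<^sup>+s. ennreal (q s) \<partial>n) < \<infinity>"
    and Nq: "prm_nn_integral M n N (\<lambda>s. ennreal (q s)) Nq"
    and K [measurable]: "K \<in> borel_measurable (cyl UNIV \<Otimes>\<^sub>M borel)"
  shows "(\<integral>\<^sup>+\<omega>. K (\<lambda>t. X t \<omega>, Nq \<omega>) * Nq \<omega> \<partial>M) =
    (\<integral>\<^sup>+s. (\<integral>\<^sup>+\<omega>. K (\<lambda>t. X t \<omega> + V t s, Nq \<omega> + ennreal (q s)) \<partial>M) * ennreal (q s) \<partial>n)"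
proof -
  have [measurable]: "Nq \<in> borel_measurable M" using Nq by (simp add: prm_nn_integral_def)
  have V [measurable]: "V t \<in> borel_measurable n" for t
    using Y[of t] by (simp add: has_increment_def)
  have Nq_fin: "AE \<omega> in M. Nq \<omega> < \<infinity>"
    using nn_integral_PInf_AE[of Nq M] nn_integral_prm_nn_integral_mean[OF Nq q_fin] q_fin
    by (auto simp: less_top)
  define Z where "Z = case_option (\<lambda>\<omega>. enn2real (Nq \<omega>)) X"
  define h where "h = case_option (\<lambda>s. enn2real (ennreal (q s))) V"
  define W where "W = case_option (\<lambda>\<omega>. enn2real (Nq \<omega>)) Y"
  define \<xi> where "\<xi> = case_option (\<lambda>_. 0) \<zeta>"
  define pr where "pr x = (\<lambda>t. x (Some t), ennreal (x None))" for x :: "'t option \<Rightarrow> real"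
  have W: "has_increment (W i) (h i)" for i
  proof (cases i)
    case None
    have "has_increment (\<lambda>\<omega>. enn2real (Nq \<omega>)) (\<lambda>s. enn2real (ennreal (q s)))"
      using Nq by (rule has_increment_nn_integral) (use q_fin Nq_fin in auto)
    then show ?thesis by (simp add: W_def h_def None)
  qed (simp add: W_def h_def Y)
  have h [measurable]: "h i \<in> borel_measurable n" for i
    using W[of i] by (simp add: has_increment_def)
  have \<xi>: "\<xi> i \<in> borel_measurable R" for i using \<zeta> by (cases i) (auto simp: \<xi>_def)
  have Z [measurable]: "Z i \<in> borel_measurable M" for i by (cases i) (auto simp: Z_def)
  have ZW: "AE \<omega> in M. Z i \<omega> = \<xi> i (G \<omega>) + W i \<omega>" for i
    using XY by (cases i) (auto simp: Z_def W_def \<xi>_def)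
  have pr [measurable]: "pr \<in> measurable (cyl UNIV) (cyl UNIV \<Otimes>\<^sub>M borel)"
    unfolding pr_def by (intro measurable_Pair measurable_PiM_single') auto
  have Kpr [measurable]: "(\<lambda>x. K (pr x)) \<in> borel_measurable (cyl UNIV)" by measurable
  have Zp: "(\<lambda>\<omega> i. Z i \<omega>) \<in> measurable M (cyl UNIV)"
    by (rule measurable_PiM_single') auto
  have Zhp: "(\<lambda>x i. Z i (snd x) + h i (fst x)) \<in> measurable (n \<Otimes>\<^sub>M M) (cyl UNIV)"
    by (rule measurable_PiM_single') auto
  have "(\<integral>\<^sup>+\<omega>. K (\<lambda>t. X t \<omega>, Nq \<omega>) * Nq \<omega> \<partial>M) = (\<integral>\<^sup>+\<omega>. K (pr (\<lambda>i. Z i \<omega>)) * Nq \<omega> \<partial>M)"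
    using Nq_fin by (intro nn_integral_cong_AE) (auto simp: pr_def Z_def less_top)
  also have "\<dots> = (\<integral>\<^sup>+s. (\<integral>\<^sup>+\<omega>. K (pr (\<lambda>i. Z i \<omega> + h i s)) \<partial>M) * ennreal (q s) \<partial>n)"
  proof (rule nn_integral_prm_nn_integral[OF _ _ _ Nq q_fin])
    show "(\<lambda>\<omega>. K (pr (\<lambda>i. Z i \<omega>))) \<in> borel_measurable M"
      by (rule measurable_compose[OF Zp Kpr])
    have "(\<lambda>x. K (pr (\<lambda>i. Z i (snd x) + h i (fst x)))) \<in> borel_measurable (n \<Otimes>\<^sub>M M)"
      by (rule measurable_compose[OF Zhp Kpr])
    then show "(\<lambda>s. \<integral>\<^sup>+\<omega>. K (pr (\<lambda>i. Z i \<omega> + h i s)) \<partial>M) \<in> borel_measurable n"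
      by (intro borel_measurable_nn_integral) (simp add: split_beta')
  qed (rule nn_integral_path_Mecke[OF W \<xi> Z ZW _ _ Kpr])
  also have "\<dots> = (\<integral>\<^sup>+s. (\<integral>\<^sup>+\<omega>. K (\<lambda>t. X t \<omega> + V t s, Nq \<omega> + ennreal (q s)) \<partial>M) * ennreal (q s) \<partial>n)"
  proof (rule nn_integral_cong, rule arg_cong2[where f="(*)"], rule nn_integral_cong_AE)
    fix s
    show "AE \<omega> in M. K (pr (\<lambda>i. Z i \<omega> + h i s)) = K (\<lambda>t. X t \<omega> + V t s, Nq \<omega> + ennreal (q s))"
      using Nq_fin by eventually_elim (simp add: pr_def Z_def h_def less_top)
  qed simp
  finally show ?thesis .
qed

end

theorem theorem4p4:
  fixes M :: "'w measure" and n :: "'s measure"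
    and X G J :: "'t \<Rightarrow> 'w \<Rightarrow> real" and V :: "'t \<Rightarrow> 's \<Rightarrow> real" and b :: "'t \<Rightarrow> real"
    and \<nu> :: "('t \<Rightarrow> real) measure" and N :: "'s set \<Rightarrow> 'w \<Rightarrow> ennreal"
    and chi :: "real \<Rightarrow> real" and q :: "'s \<Rightarrow> real" and Nq :: "'w \<Rightarrow> ennreal"
    and F :: "('t \<Rightarrow> real) \<Rightarrow> real"
  assumes "prob_space M"
    and "sigma_finite_measure n"
    and "infinitely_divisible_process M X"
    and "levy_measure_of M X \<nu>"
    and "levy_representation n V \<nu>"
    and "poisson_random_measure M n N"
    and "centered_gaussian_process M G"
    and "indep_process_prm M G n N"
    and "cutoff_function chi"
    and "\<And>t. prm_cutoff_integral M n N chi (V t) (J t)"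
    and "\<And>t. AE \<omega> in M. X t \<omega> = G t \<omega> + J t \<omega> + b t"
    and "q \<in> borel_measurable n" and "\<And>s. s \<in> space n \<Longrightarrow> 0 \<le> q s"
    and "(\<integral>\<^sup>+s. ennreal (q s) \<partial>n) = 1"
    and "prm_nn_integral M n N (\<lambda>s. ennreal (q s)) Nq"
    and "F \<in> borel_measurable (cyl UNIV)"
  shows "ext_iterated n q M (\<lambda>s \<omega>. ereal (F (\<lambda>t. X t \<omega> + V t s))) =
         ext_expectation M (\<lambda>\<omega>. ereal (F (\<lambda>t. X t \<omega>)) * enn2ereal (Nq \<omega>))
    \<and> ext_expectation M (\<lambda>\<omega>. ereal (F (\<lambda>t. X t \<omega>)) * indicator {\<omega>. Nq \<omega> > 0} \<omega>) =
         ext_iterated n q M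
           (\<lambda>s \<omega>. ereal (F (\<lambda>t. X t \<omega> + V t s)) * enn2ereal (inverse (Nq \<omega> + ennreal (q s))))
    \<and> (emeasure n {s \<in> space n. q s > 0} = \<infinity> \<longrightarrow>
         ext_expectation M (\<lambda>\<omega>. ereal (F (\<lambda>t. X t \<omega>))) =
         ext_iterated n q M
           (\<lambda>s \<omega>. ereal (F (\<lambda>t. X t \<omega> + V t s)) * enn2ereal (inverse (Nq \<omega> + ennreal (q s)))))"
proof -
  note prob = assms(1) and prm = assms(6) and indep = assms(8)
    and q = assms(12) and q_nonneg = assms(13) and q_int = assms(14) and Nq = assms(15) and F = assms(16)
  interpret M: prob_space M by (rule prob)
  have G: "G t \<in> borel_measurable M" for t
    using assms(7) by (simp add: centered_gaussian_process_def)
  have X [measurable]: "X t \<in> borel_measurable M" for t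
    using assms(3) by (simp add: infinitely_divisible_process_def)
  interpret poisson_noise_indep M n N "cyl UNIV" "\<lambda>\<omega> t. G t \<omega>"
  proof
    show "poisson_random_measure M n N" by (rule prm)
    show "(\<lambda>\<omega> t. G t \<omega>) \<in> measurable M (cyl UNIV)"
      using G by (intro measurable_PiM_single') auto
    show "M.indep_set {(\<lambda>\<omega> t. G t \<omega>) -` B \<inter> space M |B. B \<in> sets (cyl UNIV)}
        {(\<lambda>\<omega>. \<lambda>A\<in>sets n. N A \<omega>) -` B \<inter> space M |B. B \<in> sets (PiM (sets n) (\<lambda>_. borel))}"
      using indep by (simp add: indep_process_prm_def)
  qed
  have "\<forall>t. \<exists>Y. has_increment Y (V t) \<and> (AE \<omega> in M. J t \<omega> = Y \<omega>)"
    using assms(10) has_increment_cutoff_integral by blast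
  then obtain Y where Y: "\<And>t. has_increment (Y t) (V t)" and JY: "\<And>t. AE \<omega> in M. J t \<omega> = Y t \<omega>"
    by metis
  have XY: "AE \<omega> in M. X t \<omega> = (G t \<omega> + b t) + Y t \<omega>" for t
    using assms(11)[of t] JY[of t] by eventually_elim simp
  have V [measurable]: "V t \<in> borel_measurable n" for t
    using Y[of t] by (simp add: has_increment_def)
  have Nq_meas [measurable]: "Nq \<in> borel_measurable M" using Nq by (simp add: prm_nn_integral_def)
  note [measurable] = q F
  have q_fin: "(\<integral>\<^sup>+s. ennreal (q s) \<partial>n) < \<infinity>" using q_int by simp
  have Nq_fin: "AE \<omega> in M. Nq \<omega> < \<infinity>"
    using nn_integral_PInf_AE[of Nq M] nn_integral_prm_nn_integral_mean[OF Nq q_fin] q_int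
    by (auto simp: less_top)
  have Mecke: "(\<integral>\<^sup>+\<omega>. K (\<lambda>t. X t \<omega>, Nq \<omega>) * Nq \<omega> \<partial>M) =
      (\<integral>\<^sup>+s. (\<integral>\<^sup>+\<omega>. K (\<lambda>t. X t \<omega> + V t s, Nq \<omega> + ennreal (q s)) \<partial>M) * ennreal (q s) \<partial>n)"
    if "K \<in> borel_measurable (cyl UNIV \<Otimes>\<^sub>M borel)" for K
    by (rule nn_integral_weighted_Mecke[where \<zeta>="\<lambda>t z. z t + b t", OF Y _ X XY q q_fin Nq that]) measurable
  have XV: "(\<lambda>x t. X t (snd x) + V t (fst x)) \<in> measurable (n \<Otimes>\<^sub>M M) (cyl UNIV)"
    by (rule measurable_PiM_single') auto
  have FXV [measurable]: "(\<lambda>x. F (\<lambda>t. X t (snd x) + V t (fst x))) \<in> borel_measurable (n \<Otimes>\<^sub>M M)"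
    by (rule measurable_compose[OF XV F])

  \<comment> \<open>The measurable \<open>H\<close> below stands for the identity and for the negation: positive and negative part of \<open>F\<close>.\<close>
  have part1: "ext_iterated n q M (\<lambda>s \<omega>. ereal (F (\<lambda>t. X t \<omega> + V t s))) =
         ext_expectation M (\<lambda>\<omega>. ereal (F (\<lambda>t. X t \<omega>)) * enn2ereal (Nq \<omega>))"
  proof (rule ext_iterated_eq_ext_expectation[OF M.sigma_finite_measure_axioms _ q q_nonneg])
    show "(\<lambda>(s, \<omega>). ereal (F (\<lambda>t. X t \<omega> + V t s))) \<in> borel_measurable (n \<Otimes>\<^sub>M M)"
      by (simp add: split_beta')
    have "(\<integral>\<^sup>+s. (\<integral>\<^sup>+\<omega>. ennreal (H (F (\<lambda>t. X t \<omega> + V t s))) \<partial>M) * ennreal (q s) \<partial>n) =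
        (\<integral>\<^sup>+\<omega>. ennreal (H (F (\<lambda>t. X t \<omega>))) * Nq \<omega> \<partial>M)"
      if [measurable]: "H \<in> borel_measurable borel" for H :: "real \<Rightarrow> real"
      using Mecke[of "\<lambda>x. ennreal (H (F (fst x)))"] by simp
    from this[of "\<lambda>x. x"] this[of uminus]
    show "(\<integral>\<^sup>+s. (\<integral>\<^sup>+\<omega>. e2ennreal (ereal (F (\<lambda>t. X t \<omega> + V t s))) \<partial>M) * ennreal (q s) \<partial>n) =
        (\<integral>\<^sup>+\<omega>. e2ennreal (ereal (F (\<lambda>t. X t \<omega>)) * enn2ereal (Nq \<omega>)) \<partial>M)"
      "(\<integral>\<^sup>+s. (\<integral>\<^sup>+\<omega>. e2ennreal (- ereal (F (\<lambda>t. X t \<omega> + V t s))) \<partial>M) * ennreal (q s) \<partial>n) =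
        (\<integral>\<^sup>+\<omega>. e2ennreal (- (ereal (F (\<lambda>t. X t \<omega>)) * enn2ereal (Nq \<omega>))) \<partial>M)"
      by (simp_all add: e2ennreal_ereal_times flip: ereal_mult_minus_left)
  qed auto

  have part2: "ext_iterated n q M
           (\<lambda>s \<omega>. ereal (F (\<lambda>t. X t \<omega> + V t s)) * enn2ereal (inverse (Nq \<omega> + ennreal (q s)))) =
         ext_expectation M (\<lambda>\<omega>. ereal (F (\<lambda>t. X t \<omega>)) * indicator {\<omega>. Nq \<omega> > 0} \<omega>)"
  proof (rule ext_iterated_eq_ext_expectation[OF M.sigma_finite_measure_axioms _ q q_nonneg])
    show "(\<lambda>(s, \<omega>). ereal (F (\<lambda>t. X t \<omega> + V t s)) * enn2ereal (inverse (Nq \<omega> + ennreal (q s))))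
        \<in> borel_measurable (n \<Otimes>\<^sub>M M)"
      by (simp add: split_beta')
    have ind: "e2ennreal (ereal x * indicator A \<omega>) = ennreal x * indicator A \<omega>" for x A and \<omega> :: 'w
      by (simp add: indicator_def)
    have "(\<integral>\<^sup>+s. (\<integral>\<^sup>+\<omega>. ennreal (H (F (\<lambda>t. X t \<omega> + V t s))) * inverse (Nq \<omega> + ennreal (q s)) \<partial>M) * ennreal (q s) \<partial>n) =
        (\<integral>\<^sup>+\<omega>. ennreal (H (F (\<lambda>t. X t \<omega>))) * indicator {\<omega>. Nq \<omega> > 0} \<omega> \<partial>M)"
      if [measurable]: "H \<in> borel_measurable borel" for H :: "real \<Rightarrow> real"
    proof -
      have "(\<integral>\<^sup>+s. (\<integral>\<^sup>+\<omega>. ennreal (H (F (\<lambda>t. X t \<omega> + V t s))) * inverse (Nq \<omega> + ennreal (q s)) \<partial>M) * ennreal (q s) \<partial>n) =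
          (\<integral>\<^sup>+\<omega>. ennreal (H (F (\<lambda>t. X t \<omega>))) * inverse (Nq \<omega>) * Nq \<omega> \<partial>M)"
        using Mecke[of "\<lambda>x. ennreal (H (F (fst x))) * inverse (snd x)"] by simp
      also have "\<dots> = (\<integral>\<^sup>+\<omega>. ennreal (H (F (\<lambda>t. X t \<omega>))) * indicator {\<omega>. Nq \<omega> > 0} \<omega> \<partial>M)"
      proof (rule nn_integral_cong_AE)
        show "AE \<omega> in M. ennreal (H (F (\<lambda>t. X t \<omega>))) * inverse (Nq \<omega>) * Nq \<omega> =
            ennreal (H (F (\<lambda>t. X t \<omega>))) * indicator {\<omega>. Nq \<omega> > 0} \<omega>"
          using Nq_fin
        proof eventually_elim
          case (elim \<omega>)
          \<comment> \<open>At 0 the inverse is infinite, but its product with 0 is 0, as the indicator requires.\<close>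
          have "inverse (Nq \<omega>) * Nq \<omega> = indicator {\<omega>. Nq \<omega> > 0} \<omega>"
            using elim ennreal_divide_self[of "Nq \<omega>"]
            by (cases "Nq \<omega> = 0") (auto simp: divide_ennreal_def zero_less_iff_neq_zero mult.commute)
          then show ?case by (simp add: mult.assoc)
        qed
      qed
      finally show ?thesis .
    qed
    from this[of "\<lambda>x. x"] this[of uminus]
    show "(\<integral>\<^sup>+s. (\<integral>\<^sup>+\<omega>. e2ennreal (ereal (F (\<lambda>t. X t \<omega> + V t s)) * enn2ereal (inverse (Nq \<omega> + ennreal (q s)))) \<partial>M)
          * ennreal (q s) \<partial>n) =
        (\<integral>\<^sup>+\<omega>. e2ennreal (ereal (F (\<lambda>t. X t \<omega>)) * indicator {\<omega>. Nq \<omega> > 0} \<omega>) \<partial>M)"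
      "(\<integral>\<^sup>+s. (\<integral>\<^sup>+\<omega>. e2ennreal (- (ereal (F (\<lambda>t. X t \<omega> + V t s)) * enn2ereal (inverse (Nq \<omega> + ennreal (q s))))) \<partial>M)
          * ennreal (q s) \<partial>n) =
        (\<integral>\<^sup>+\<omega>. e2ennreal (- (ereal (F (\<lambda>t. X t \<omega>)) * indicator {\<omega>. Nq \<omega> > 0} \<omega>)) \<partial>M)"
      by (simp_all add: e2ennreal_ereal_times ind flip: ereal_mult_minus_left)
  qed auto

  have part3: "ext_expectation M (\<lambda>\<omega>. ereal (F (\<lambda>t. X t \<omega>))) =
      ext_expectation M (\<lambda>\<omega>. ereal (F (\<lambda>t. X t \<omega>)) * indicator {\<omega>. Nq \<omega> > 0} \<omega>)"
    if "emeasure n {s \<in> space n. q s > 0} = \<infinity>"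
  proof (rule ext_expectation_cong_AE)
    have "AE \<omega> in M. Nq \<omega> > 0"
      by (rule AE_prm_nn_integral_pos[OF Nq _ q_fin]) (use that in auto)
    then show "AE \<omega> in M. ereal (F (\<lambda>t. X t \<omega>)) = ereal (F (\<lambda>t. X t \<omega>)) * indicator {\<omega>. Nq \<omega> > 0} \<omega>"
      by eventually_elim simp
  qed
  show ?thesis using part1 part2 part3 by simp
qed

end
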